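(* Let $V$ be a complex-analytic Lie group, $\gimel\subset V$ a subgroup and $v\in V$. Assume that $\mathcal A\subset\mathcal S(V)$ is a subalgebra finitely generated over $H^0(V,\mathcal O)$ that preserves the vector space $\mathfrak O|_{\gimel\cdot v}$, that $H^0(V,\mathcal O)$ separates points of $\gimel\cdot v$, and that the graph $\Gamma$ is connected as an oriented graph. Then the $\mathcal A$-module $M(\{e\},\gimel\cdot v)$ is irreducible.
   Context: $\mathcal O$ and $\mathcal M$ are the sheaves of holomorphic and meromorphic functions on $V$, with germs $\mathcal O_x,\mathcal M_x$; $H^0(V,\mathcal O)$ is the algebra of global holomorphic functions. For $\xi\in V$, $\phi_\xi$ is left translation $x\mapsto\xi x$, acting on germs by $\phi_\xi(f)(x)=f(\xi^{-1}x)$. $\mathcal S(V)$ is the skew-group ring of finite sums $\sum_i f_i\phi_{\xi_i}$ with $f_i$ meromorphic on $V$ and $\xi_i\in V$, with product $f\phi_\xi\circ f'\phi_{\xi'}=f\,\phi_\xi(f')\,\phi_{\xi\xi'}$; it acts on $\bigoplus_{x\in V}\mathcal M_x$ by $f\phi_\xi:\mathcal M_x\to\mathcal M_{\xi x}$, $F\mapsto f\phi_\xi(F)$. $\gimel\cdot v=\{\xi v:\xi\in\gimel\}$ and $\mathfrak O|_{\gimel\cdot v}=\bigoplus_{x\in\gimel\cdot v}\mathcal O_x$. "Finitely generated over $H^0(V,\mathcal O)$" means that $\mathcal A$ contains $H^0(V,\mathcal O)$ and is generated by it and finitely many elements. $\Gamma$ is the oriented graph whose vertices are the points of $\gimel\cdot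 v$, with an arrow $x\to y$ if there exist $A=\sum_i f_i\phi_{\xi_i}\in\mathcal A$ (with distinct $\xi_i$) and an index $i_0$ such that $\phi_{\xi_{i_0}}(x)=y$ and $f_{i_0}(y)\ne0$ (since $\mathcal A$ preserves $\mathfrak O|_{\gimel\cdot v}$, the $f_i$ are holomorphic at points of $\gimel\cdot v$). "Connected as an oriented graph" means that for any two vertices $x,y$ there is an oriented path from $x$ to $y$. $M(\{e\},\gimel\cdot v)=\bigoplus_{x\in\gimel\cdot v}\mathcal O_x/\mathfrak m_x$, where $\mathfrak m_x$ is the ideal of germs vanishing at $x$, with the $\mathcal A$-action induced from that on $\mathfrak O|_{\gimel\cdot v}$. Equivalently, it is the space of finite linear combinations of points of $\gimel\cdot v$ with $A(x)=\sum_i f_i(\xi_i x)\,\xi_i x$ for $A=\sum_i f_i\phi_{\xi_i}$. *)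

theory Defs
  imports "HOL-Analysis.Analysis" "HOL-Algebra.QuotRing" "HOL-Algebra.Generated_Rings"
begin

section \<open>Complex-analytic Lie groups\<close>

text \<open>
  The Lie group is a group in the sense of \<open>HOL-Algebra\<close> whose carrier is a whole topological
  type. Charts take values in a complex-linear subspace \<open>E\<close> of \<open>complex ^ 'n\<close>; this \<open>E\<close> is an
  arbitrary finite-dimensional complex vector space, including \<open>E = {0}\<close>, which the
  type \<open>complex ^ 'n\<close> alone would exclude. A chart is a domain together with a map that is only
  relevant on that domain.
\<close>

type_synonym ('a, 'e) atlas = "('a set \<times> ('a \<Rightarrow> 'e)) set"

text \<open>
  Complex differentiability at every point of \<open>W\<close>: real Frechet derivatives which are linear for
  the scalar multiplications \<open>s\<close> and \<open>t\<close> of the two complex vector spaces. The set \<open>W\<close> is always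
  relatively open in the model space \<open>E\<close> (or \<open>E \<times> E\<close>), hence the derivative is taken within \<open>W\<close>;
  every complex-linear map on \<open>E\<close> extends to the surrounding space, so that asking for linearity
  on the surrounding space is no restriction.
\<close>

definition complex_differentiable_on ::
  "(complex \<Rightarrow> 'e \<Rightarrow> 'e) \<Rightarrow> (complex \<Rightarrow> 'f \<Rightarrow> 'f) \<Rightarrow> 'e set \<Rightarrow>
    ('e::real_normed_vector \<Rightarrow> 'f::real_normed_vector) \<Rightarrow> bool"
where
  "complex_differentiable_on s t W f \<longleftrightarrow>
    (\<forall>z\<in>W. \<exists>D. (f has_derivative D) (at z within W) \<and> (\<forall>c w. D (s c w) = t c (D w)))"

definition complex_atlas ::
  "(complex ^ 'n) set \<Rightarrow> ('a::t2_space, complex ^ 'n::finite) atlas \<Rightarrow> bool"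
where
  "complex_atlas E \<Phi> \<longleftrightarrow>
    vec.subspace E \<and>
    (\<Union>(U, \<phi>)\<in>\<Phi>. U) = UNIV \<and>
    (\<forall>(U, \<phi>)\<in>\<Phi>. open U \<and> openin (top_of_set E) (\<phi> ` U) \<and>
      homeomorphism U (\<phi> ` U) \<phi> (inv_into U \<phi>)) \<and>
    (\<forall>(U, \<phi>)\<in>\<Phi>. \<forall>(W, \<psi>)\<in>\<Phi>.
      complex_differentiable_on (*s) (*s) (\<phi> ` (U \<inter> W)) (\<psi> \<circ> inv_into U \<phi>))"

definition holomorphic_map ::
  "(complex \<Rightarrow> 'e \<Rightarrow> 'e) \<Rightarrow> (complex \<Rightarrow> 'f \<Rightarrow> 'f) \<Rightarrow>
    ('a::topological_space, 'e::real_normed_vector) atlas \<Rightarrow>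
    ('b::topological_space, 'f::real_normed_vector) atlas \<Rightarrow> ('a \<Rightarrow> 'b) \<Rightarrow> bool"
where
  "holomorphic_map s t \<Phi> \<Psi> F \<longleftrightarrow>
    continuous_on UNIV F \<and>
    (\<forall>(U, \<phi>)\<in>\<Phi>. \<forall>(W, \<psi>)\<in>\<Psi>.
      complex_differentiable_on s t (\<phi> ` (U \<inter> F -` W)) (\<psi> \<circ> F \<circ> inv_into U \<phi>))"

definition product_atlas :: "('a, 'e) atlas \<Rightarrow> ('b, 'f) atlas \<Rightarrow> ('a \<times> 'b, 'e \<times> 'f) atlas"
where
  "product_atlas \<Phi> \<Psi> = {(U \<times> W, map_prod \<phi> \<psi>) | U \<phi> W \<psi>. (U, \<phi>) \<in> \<Phi> \<and> (W, \<psi>) \<in> \<Psi>}"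

definition complex_lie_group ::
  "'a::t2_space monoid \<Rightarrow> (complex ^ 'n) set \<Rightarrow> ('a, complex ^ 'n::finite) atlas \<Rightarrow> bool"
where
  "complex_lie_group V E \<Phi> \<longleftrightarrow>
    group V \<and> carrier V = UNIV \<and> complex_atlas E \<Phi> \<and>
    holomorphic_map (\<lambda>c. map_prod ((*s) c) ((*s) c)) (*s) (product_atlas \<Phi> \<Phi>) \<Phi>
      (\<lambda>(x, y). x \<otimes>\<^bsub>V\<^esub> y) \<and>
    holomorphic_map (*s) (*s) \<Phi> \<Phi> (\<lambda>x. inv\<^bsub>V\<^esub> x)"


section \<open>Holomorphic and meromorphic functions\<close>

definition holo_on ::
  "('a::t2_space, complex ^ 'n::finite) atlas \<Rightarrow> 'a set \<Rightarrow> ('a \<Rightarrow> complex) \<Rightarrow> bool"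
where
  "holo_on \<Phi> S f \<longleftrightarrow>
    (\<forall>(U, \<phi>)\<in>\<Phi>. complex_differentiable_on (*s) (*) (\<phi> ` (U \<inter> S)) (f \<circ> inv_into U \<phi>))"

definition holo_near ::
  "('a::t2_space, complex ^ 'n::finite) atlas \<Rightarrow> 'a \<Rightarrow> ('a \<Rightarrow> complex) \<Rightarrow> bool"
where
  "holo_near \<Phi> x f \<longleftrightarrow> (\<exists>S. open S \<and> x \<in> S \<and> holo_on \<Phi> S f)"

text \<open>
  A meromorphic germ at \<open>x\<close> is a class of pairs \<open>(g, h)\<close>, standing for \<open>g / h\<close>, of functions
  holomorphic near \<open>x\<close> with \<open>h\<close> of nonzero germ: an element of the field of fractions of the
  ring of holomorphic germs. Two pairs are identified when \<open>g h' = g' h\<close> near \<open>x\<close>, so passing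
  to germs and passing to fractions is done in one step.
\<close>

type_synonym 'a mgerm = "(('a \<Rightarrow> complex) \<times> ('a \<Rightarrow> complex)) set"

definition frac_rel ::
  "('a::t2_space, complex ^ 'n::finite) atlas \<Rightarrow> 'a \<Rightarrow>
    ((('a \<Rightarrow> complex) \<times> ('a \<Rightarrow> complex)) \<times> (('a \<Rightarrow> complex) \<times> ('a \<Rightarrow> complex))) set"
where
  "frac_rel \<Phi> x = {((g, h), (g', h')).
    holo_near \<Phi> x g \<and> holo_near \<Phi> x h \<and> \<not> (\<forall>\<^sub>F y in nhds x. h y = 0) \<and>
    holo_near \<Phi> x g' \<and> holo_near \<Phi> x h' \<and> \<not> (\<forall>\<^sub>F y in nhds x. h' y = 0) \<and>
    (\<forall>\<^sub>F y in nhds x. g y * h' y = g' y * h y)}"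

definition quot_germ ::
  "('a::t2_space, complex ^ 'n::finite) atlas \<Rightarrow> 'a \<Rightarrow> ('a \<Rightarrow> complex) \<Rightarrow> ('a \<Rightarrow> complex) \<Rightarrow> 'a mgerm"
where
  "quot_germ \<Phi> x g h = frac_rel \<Phi> x `` {(g, h)}"

text \<open>The field of meromorphic germs at \<open>x\<close>.\<close>

definition mero_stalk ::
  "('a::t2_space, complex ^ 'n::finite) atlas \<Rightarrow> 'a \<Rightarrow> 'a mgerm ring"
where
  "mero_stalk \<Phi> x = \<lparr>
    carrier = Field (frac_rel \<Phi> x) // frac_rel \<Phi> x,
    mult = (\<lambda>F G. \<Union>(g, h)\<in>F. \<Union>(g', h')\<in>G. quot_germ \<Phi> x (\<lambda>y. g y * g' y) (\<lambda>y. h y * h' y)),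
    one = quot_germ \<Phi> x (\<lambda>y. 1) (\<lambda>y. 1),
    zero = quot_germ \<Phi> x (\<lambda>y. 0) (\<lambda>y. 1),
    add = (\<lambda>F G. \<Union>(g, h)\<in>F. \<Union>(g', h')\<in>G.
      quot_germ \<Phi> x (\<lambda>y. g y * h' y + g' y * h y) (\<lambda>y. h y * h' y))\<rparr>"

text \<open>The ring of holomorphic germs at \<open>x\<close>, as a subring of the field of meromorphic germs, and
  its ideal of germs vanishing at \<open>x\<close>.\<close>

definition holo_stalk ::
  "('a::t2_space, complex ^ 'n::finite) atlas \<Rightarrow> 'a \<Rightarrow> 'a mgerm ring"
where
  "holo_stalk \<Phi> x = (mero_stalk \<Phi> x)
    \<lparr>carrier := {quot_germ \<Phi> x g (\<lambda>y. 1) | g. holo_near \<Phi> x g}\<rparr>"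

definition vanishing_germs ::
  "('a::t2_space, complex ^ 'n::finite) atlas \<Rightarrow> 'a \<Rightarrow> 'a mgerm set"
where
  "vanishing_germs \<Phi> x = {quot_germ \<Phi> x g (\<lambda>y. 1) | g. holo_near \<Phi> x g \<and> g x = 0}"

text \<open>Global sections of the sheaf of meromorphic functions: families of germs which are locally
  given by one quotient of holomorphic functions.\<close>

definition meromorphic_functions ::
  "('a::t2_space, complex ^ 'n::finite) atlas \<Rightarrow> ('a \<Rightarrow> 'a mgerm) ring"
where
  "meromorphic_functions \<Phi> = \<lparr>
    carrier = {f. \<forall>x. \<exists>S g h. open S \<and> x \<in> S \<and> holo_on \<Phi> S g \<and> holo_on \<Phi> S h \<and>
      (\<forall>y\<in>S. \<not> (\<forall>\<^sub>F z in nhds y. h z = 0) \<and> f y = quot_germ \<Phi> y g h)},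
    mult = (\<lambda>f f' x. f x \<otimes>\<^bsub>mero_stalk \<Phi> x\<^esub> f' x),
    one = (\<lambda>x. \<one>\<^bsub>mero_stalk \<Phi> x\<^esub>),
    zero = (\<lambda>x. \<zero>\<^bsub>mero_stalk \<Phi> x\<^esub>),
    add = (\<lambda>f f' x. f x \<oplus>\<^bsub>mero_stalk \<Phi> x\<^esub> f' x)\<rparr>"

text \<open>The map \<open>\<phi>\<^sub>\<xi>\<close>, from germs at \<open>x\<close> to germs at \<open>\<xi> x\<close>, and on global sections. Representatives are
  functions on all of the group, so the image of a class is again a class.\<close>

definition translate_germ :: "'a monoid \<Rightarrow> 'a \<Rightarrow> 'a mgerm \<Rightarrow> 'a mgerm"
where
  "translate_germ V \<xi> F =
    (\<lambda>(g, h). (\<lambda>x. g (inv\<^bsub>V\<^esub> \<xi> \<otimes>\<^bsub>V\<^esub> x), \<lambda>x. h (inv\<^bsub>V\<^esub> \<xi> \<otimes>\<^bsub>V\<^esub> x))) ` F"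

definition translate_section :: "'a monoid \<Rightarrow> 'a \<Rightarrow> ('a \<Rightarrow> 'a mgerm) \<Rightarrow> ('a \<Rightarrow> 'a mgerm)"
where
  "translate_section V \<xi> f = (\<lambda>x. translate_germ V \<xi> (f (inv\<^bsub>V\<^esub> \<xi> \<otimes>\<^bsub>V\<^esub> x)))"


section \<open>The skew-group ring and its action\<close>

text \<open>
  The finite sum \<open>\<Sum>\<^sub>i f\<^sub>i \<phi>\<^bsub>\<xi>\<^sub>i\<^esub>\<close> with distinct \<open>\<xi>\<^sub>i\<close> is the finitely supported function sending
  \<open>\<xi>\<^sub>i\<close> to \<open>f\<^sub>i\<close>.
\<close>

definition skew_support ::
  "('a::t2_space, complex ^ 'n::finite) atlas \<Rightarrow> ('a \<Rightarrow> 'a \<Rightarrow> 'a mgerm) \<Rightarrow> 'a set"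
where
  "skew_support \<Phi> A = {\<xi>. A \<xi> \<noteq> \<zero>\<^bsub>meromorphic_functions \<Phi>\<^esub>}"

definition skew_ring ::
  "'a monoid \<Rightarrow> ('a::t2_space, complex ^ 'n::finite) atlas \<Rightarrow> ('a \<Rightarrow> 'a \<Rightarrow> 'a mgerm) ring"
where
  "skew_ring V \<Phi> = \<lparr>
    carrier = {A. (\<forall>\<xi>. A \<xi> \<in> carrier (meromorphic_functions \<Phi>)) \<and> finite (skew_support \<Phi> A)},
    mult = (\<lambda>A B \<zeta>. finsum (meromorphic_functions \<Phi>)
      (\<lambda>\<xi>. A \<xi> \<otimes>\<^bsub>meromorphic_functions \<Phi>\<^esub> translate_section V \<xi> (B (inv\<^bsub>V\<^esub> \<xi> \<otimes>\<^bsub>V\<^esub> \<zeta>)))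
      (skew_support \<Phi> A)),
    one = (\<lambda>\<xi>. if \<xi> = \<one>\<^bsub>V\<^esub> then \<one>\<^bsub>meromorphic_functions \<Phi>\<^esub> else \<zero>\<^bsub>meromorphic_functions \<Phi>\<^esub>),
    zero = (\<lambda>\<xi>. \<zero>\<^bsub>meromorphic_functions \<Phi>\<^esub>),
    add = (\<lambda>A B \<xi>. A \<xi> \<oplus>\<^bsub>meromorphic_functions \<Phi>\<^esub> B \<xi>)\<rparr>"

text \<open>The algebra of global holomorphic functions, inside the skew-group ring.\<close>

definition global_holo ::
  "'a monoid \<Rightarrow> ('a::t2_space, complex ^ 'n::finite) atlas \<Rightarrow> ('a \<Rightarrow> 'a \<Rightarrow> 'a mgerm) set"
where
  "global_holo V \<Phi> =
    {\<lambda>\<xi>. if \<xi> = \<one>\<^bsub>V\<^esub> then (\<lambda>x. quot_germ \<Phi> x f (\<lambda>y. 1)) else \<zero>\<^bsub>meromorphic_functions \<Phi>\<^esub> | f.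
      holo_on \<Phi> UNIV f}"

text \<open>Subrings containing the global holomorphic functions contain the complex constants, so they
  are automatically complex subalgebras.\<close>

definition finitely_generated_over_holo ::
  "'a monoid \<Rightarrow> ('a::t2_space, complex ^ 'n::finite) atlas \<Rightarrow> ('a \<Rightarrow> 'a \<Rightarrow> 'a mgerm) set \<Rightarrow> bool"
where
  "finitely_generated_over_holo V \<Phi> \<A> \<longleftrightarrow>
    (\<exists>X. finite X \<and> X \<subseteq> carrier (skew_ring V \<Phi>) \<and>
      \<A> = generate_ring (skew_ring V \<Phi>) (global_holo V \<Phi> \<union> X))"

text \<open>Elements of direct sums of stalks are families of germs; the component at \<open>y\<close> of the image of
  \<open>u\<close> under \<open>\<Sum>\<^sub>i f\<^sub>i \<phi>\<^bsub>\<xi>\<^sub>i\<^esub>\<close> comes from the components of \<open>u\<close> at the points \<open>\<xi>\<^sub>i\<^sup>-\<^sup>1 y\<close>.\<close>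

definition skew_act ::
  "'a monoid \<Rightarrow> ('a::t2_space, complex ^ 'n::finite) atlas \<Rightarrow> ('a \<Rightarrow> 'a \<Rightarrow> 'a mgerm) \<Rightarrow>
    ('a \<Rightarrow> 'a mgerm) \<Rightarrow> ('a \<Rightarrow> 'a mgerm)"
where
  "skew_act V \<Phi> A u = (\<lambda>y. finsum (mero_stalk \<Phi> y)
    (\<lambda>\<xi>. A \<xi> y \<otimes>\<^bsub>mero_stalk \<Phi> y\<^esub> translate_germ V \<xi> (u (inv\<^bsub>V\<^esub> \<xi> \<otimes>\<^bsub>V\<^esub> y)))
    (skew_support \<Phi> A))"

definition holo_germs_on ::
  "('a::t2_space, complex ^ 'n::finite) atlas \<Rightarrow> 'a set \<Rightarrow> ('a \<Rightarrow> 'a mgerm) set"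
where
  "holo_germs_on \<Phi> Y = {u. (\<forall>x\<in>Y. u x \<in> carrier (holo_stalk \<Phi> x)) \<and>
    (\<forall>x. x \<notin> Y \<longrightarrow> u x = \<zero>\<^bsub>mero_stalk \<Phi> x\<^esub>) \<and> finite {x. u x \<noteq> \<zero>\<^bsub>mero_stalk \<Phi> x\<^esub>}}"

definition preserves_holo_germs ::
  "'a monoid \<Rightarrow> ('a::t2_space, complex ^ 'n::finite) atlas \<Rightarrow> ('a \<Rightarrow> 'a \<Rightarrow> 'a mgerm) set \<Rightarrow>
    'a set \<Rightarrow> bool"
where
  "preserves_holo_germs V \<Phi> \<A> Y \<longleftrightarrow>
    (\<forall>A\<in>\<A>. \<forall>u\<in>holo_germs_on \<Phi> Y. skew_act V \<Phi> A u \<in> holo_germs_on \<Phi> Y)"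

definition holo_separates_points ::
  "('a::t2_space, complex ^ 'n::finite) atlas \<Rightarrow> 'a set \<Rightarrow> bool"
where
  "holo_separates_points \<Phi> Y \<longleftrightarrow>
    (\<forall>x\<in>Y. \<forall>y\<in>Y. x \<noteq> y \<longrightarrow> (\<exists>f. holo_on \<Phi> UNIV f \<and> f x \<noteq> f y))"

text \<open>The arrows of the graph with vertex set \<open>Y\<close>. The germ at \<open>y\<close> of the coefficient of \<open>\<xi>\<close> is that of
  the holomorphic function \<open>g\<close>, so \<open>g y\<close> is its value at \<open>y\<close>.\<close>

definition graph_arrows ::
  "'a monoid \<Rightarrow> ('a::t2_space, complex ^ 'n::finite) atlas \<Rightarrow> ('a \<Rightarrow> 'a \<Rightarrow> 'a mgerm) set \<Rightarrow>
    'a set \<Rightarrow> ('a \<times> 'a) set"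
where
  "graph_arrows V \<Phi> \<A> Y = {(x, y). x \<in> Y \<and> y \<in> Y \<and>
    (\<exists>A\<in>\<A>. \<exists>\<xi>\<in>carrier V. \<xi> \<otimes>\<^bsub>V\<^esub> x = y \<and>
      (\<exists>g. holo_near \<Phi> y g \<and> A \<xi> y = quot_germ \<Phi> y g (\<lambda>z. 1) \<and> g y \<noteq> 0))}"

definition oriented_connected :: "'a set \<Rightarrow> ('a \<times> 'a) set \<Rightarrow> bool"
where
  "oriented_connected Y R \<longleftrightarrow> (\<forall>x\<in>Y. \<forall>y\<in>Y. (x, y) \<in> R\<^sup>*)"


section \<open>Modules\<close>

text \<open>Left modules over a not necessarily commutative ring; the locale \<open>module\<close> requires a
  commutative one.\<close>

locale left_module = R?: ring R + M?: abelian_group M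
  for R :: "('r, 'c) ring_scheme" (structure) and M :: "('r, 'm, 'd) module_scheme" (structure) +
  assumes smult_closed:
      "\<lbrakk>a \<in> carrier R; x \<in> carrier M\<rbrakk> \<Longrightarrow> a \<odot>\<^bsub>M\<^esub> x \<in> carrier M"
    and smult_l_distr:
      "\<lbrakk>a \<in> carrier R; b \<in> carrier R; x \<in> carrier M\<rbrakk> \<Longrightarrow>
        (a \<oplus>\<^bsub>R\<^esub> b) \<odot>\<^bsub>M\<^esub> x = a \<odot>\<^bsub>M\<^esub> x \<oplus>\<^bsub>M\<^esub> b \<odot>\<^bsub>M\<^esub> x"
    and smult_r_distr:
      "\<lbrakk>a \<in> carrier R; x \<in> carrier M; y \<in> carrier M\<rbrakk> \<Longrightarrow>
        a \<odot>\<^bsub>M\<^esub> (x \<oplus>\<^bsub>M\<^esub> y) = a \<odot>\<^bsub>M\<^esub> x \<oplus>\<^bsub>M\<^esub> a \<odot>\<^bsub>M\<^esub> y"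
    and smult_assoc:
      "\<lbrakk>a \<in> carrier R; b \<in> carrier R; x \<in> carrier M\<rbrakk> \<Longrightarrow>
        (a \<otimes>\<^bsub>R\<^esub> b) \<odot>\<^bsub>M\<^esub> x = a \<odot>\<^bsub>M\<^esub> (b \<odot>\<^bsub>M\<^esub> x)"
    and smult_one:
      "x \<in> carrier M \<Longrightarrow> \<one>\<^bsub>R\<^esub> \<odot>\<^bsub>M\<^esub> x = x"

definition irreducible_module ::
  "('r, 'c) ring_scheme \<Rightarrow> ('r, 'm, 'd) module_scheme \<Rightarrow> bool"
where
  "irreducible_module R M \<longleftrightarrow>
    left_module R M \<and> carrier M \<noteq> {\<zero>\<^bsub>M\<^esub>} \<and>
    (\<forall>N. submodule N R M \<longrightarrow> N = {\<zero>\<^bsub>M\<^esub>} \<or> N = carrier M)"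

text \<open>
  The direct sum of the quotients \<open>\<O>\<^sub>x / \<mm>\<^sub>x\<close> for \<open>x \<in> Y\<close>, with the action induced from
  the one on families of holomorphic germs: to act on a family of cosets, lift it to a family of
  germs, act there, and reduce. The multiplicative fields of the record are not used.
\<close>

definition residue_module ::
  "'a monoid \<Rightarrow> ('a::t2_space, complex ^ 'n::finite) atlas \<Rightarrow> 'a set \<Rightarrow>
    ('a \<Rightarrow> 'a \<Rightarrow> 'a mgerm, 'a \<Rightarrow> 'a mgerm set) module"
where
  "residue_module V \<Phi> Y = (let Q = (\<lambda>x. holo_stalk \<Phi> x Quot vanishing_germs \<Phi> x) in \<lparr>
    carrier = {c \<in> \<Pi>\<^sub>E x\<in>Y. carrier (Q x). finite {x\<in>Y. c x \<noteq> \<zero>\<^bsub>Q x\<^esub>}},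
    mult = undefined,
    one = undefined,
    zero = (\<lambda>x\<in>Y. \<zero>\<^bsub>Q x\<^esub>),
    add = (\<lambda>c d. \<lambda>x\<in>Y. c x \<oplus>\<^bsub>Q x\<^esub> d x),
    smult = (\<lambda>A c. \<lambda>y\<in>Y. \<Union>u\<in>{u \<in> holo_germs_on \<Phi> Y. \<forall>x\<in>Y. u x \<in> c x}.
      vanishing_germs \<Phi> y +>\<^bsub>holo_stalk \<Phi> y\<^esub> skew_act V \<Phi> A u y)\<rparr>)"

end

theory Submission
  imports Defs "HOL-Complex_Analysis.Conformal_Mappings"
begin

text \<open>
  An element \<open>u\<close> of \<open>\<O>\<close> restricted to the orbit \<open>Y\<close> has a value at each point, and the residue module is
  the space of possible value functions: finitely supported functions on \<open>Y\<close>. The action descends to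
  values because \<open>\<A>\<close> preserves holomorphic germs: applying \<open>\<Sum>\<^sub>i f\<^sub>i \<phi>\<^bsub>\<xi>\<^sub>i\<^esub>\<close> to the unit germ at the single
  point \<open>\<xi>\<^sub>i\<^sup>-\<^sup>1 y\<close> returns the germ of \<open>f\<^sub>i\<close> at \<open>y\<close>, so every coefficient that links two points of \<open>Y\<close> is
  holomorphic there, and the value of \<open>A u\<close> at \<open>y\<close> is a combination of the values of \<open>u\<close>
  (\<open>coefficient_holo\<close>, \<open>germ_value_act\<close>).

  Irreducibility is then the usual argument with delta functions. Let \<open>N\<close> be a nonzero submodule and let
  \<open>c \<in> N\<close> have nonzero value at \<open>x\<close>. As \<open>c\<close> has finite support and global holomorphic functions separate
  points, some product of shifted and scaled ones is \<open>1\<close> at \<open>x\<close> and vanishes at the rest of the support; multiplying \<open>c\<close> by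
  multiples of it puts the whole line of \<open>x\<close> into \<open>N\<close> (\<open>submodule_localize\<close>). For an arrow from \<open>x\<close> to
  \<open>y\<close> the corresponding element of \<open>\<A>\<close> sends the delta function at \<open>x\<close> to something with nonzero value
  at \<open>y\<close>, so the line of \<open>y\<close> lies in \<open>N\<close> as well. Following oriented paths, \<open>N\<close> contains all lines and
  hence everything (\<open>irreducible_M\<close>).

  Behind this stands the claim that the objects involved are rings and modules at all. Sums and
  products of fractions of germs need the ring of holomorphic germs to have no zero divisors; this
  follows from the identity theorem in one variable, applied on complex lines in a chart
  (\<open>holo_germs_no_zero_divisors\<close>). The skew-group ring acts on families of meromorphic germs, its
  product is the composition of operators (\<open>act_mult\<close>), and the action is faithful (\<open>act_faithful\<close>), again
  because unit germs at single points recover the coefficients. Associativity and distributivity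
  (\<open>ring_Skew\<close>) and the module axioms (\<open>left_module_M\<close>) are inherited from operators.
\<close>

section \<open>Calculus on charts\<close>

lemma complex_differentiable_on_subset:
  "complex_differentiable_on s t W f \<Longrightarrow> W' \<subseteq> W \<Longrightarrow> complex_differentiable_on s t W' f"
  unfolding complex_differentiable_on_def by (meson has_derivative_subset subsetD)

lemma complex_differentiable_on_cong:
  assumes "complex_differentiable_on s t W f" "\<And>z. z \<in> W \<Longrightarrow> f z = g z"
  shows "complex_differentiable_on s t W g"
  unfolding complex_differentiable_on_def
proof
  fix z assume z: "z \<in> W"
  then obtain D where D: "(f has_derivative D) (at z within W)" "\<forall>c w. D (s c w) = t c (D w)"
    using assms(1) unfolding complex_differentiable_on_def by blast
  have "(g has_derivative D) (at z within W)"
    using has_derivative_transform_within[OF D(1), of 1] z assms(2) by auto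
  then show "\<exists>D. (g has_derivative D) (at z within W) \<and> (\<forall>c w. D (s c w) = t c (D w))"
    using D(2) by blast
qed

lemma complex_differentiable_on_compose:
  assumes f: "complex_differentiable_on s t W f" and g: "complex_differentiable_on t r W' g"
    and W: "f ` W \<subseteq> W'"
  shows "complex_differentiable_on s r W (\<lambda>z. g (f z))"
  unfolding complex_differentiable_on_def
proof
  fix z assume z: "z \<in> W"
  obtain D where D: "(f has_derivative D) (at z within W)" "\<forall>c w. D (s c w) = t c (D w)"
    using f z unfolding complex_differentiable_on_def by blast
  obtain D' where D': "(g has_derivative D') (at (f z) within W')" "\<forall>c w. D' (t c w) = r c (D' w)"
    using g z W unfolding complex_differentiable_on_def by blast
  have "((\<lambda>z. g (f z)) has_derivative (\<lambda>w. D' (D w))) (at z within W)"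
    using has_derivative_in_compose[OF D(1) has_derivative_subset[OF D'(1) W]] .
  then show "\<exists>D. ((\<lambda>z. g (f z)) has_derivative D) (at z within W) \<and> (\<forall>c w. D (s c w) = r c (D w))"
    using D(2) D'(2) by (intro exI[of _ "\<lambda>w. D' (D w)"]) simp
qed

text \<open>
  Charts only give information near a point, so differentiability has to be glued from pieces.
\<close>

lemma complex_differentiable_on_local:
  assumes "\<And>z. z \<in> W \<Longrightarrow> \<exists>G. open G \<and> z \<in> G \<and> complex_differentiable_on s t (W \<inter> G) f"
  shows "complex_differentiable_on s t W f"
  unfolding complex_differentiable_on_def
proof
  fix z assume z: "z \<in> W"
  obtain G where G: "open G" "z \<in> G" "complex_differentiable_on s t (W \<inter> G) f"
    using assms[OF z] by blast
  have "at z within W = at z within (W \<inter> G)"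
    by (rule at_within_nhd[OF G(2,1)]) auto
  then show "\<exists>D. (f has_derivative D) (at z within W) \<and> (\<forall>c w. D (s c w) = t c (D w))"
    using G z unfolding complex_differentiable_on_def by auto
qed

lemma complex_differentiable_on_const:
  "complex_differentiable_on s ((*) :: complex \<Rightarrow> _) W (\<lambda>z. c)"
  unfolding complex_differentiable_on_def by (auto intro!: exI[of _ "\<lambda>_. 0"])

lemma complex_differentiable_on_add:
  fixes f g :: "_ \<Rightarrow> complex"
  assumes "complex_differentiable_on s (*) W f" "complex_differentiable_on s (*) W g"
  shows "complex_differentiable_on s (*) W (\<lambda>z. f z + g z)"
  unfolding complex_differentiable_on_def
proof
  fix z assume z: "z \<in> W"
  obtain D where D: "(f has_derivative D) (at z within W)" "\<forall>c w. D (s c w) = c * D w"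
    using assms(1) z unfolding complex_differentiable_on_def by blast
  obtain D' where D': "(g has_derivative D') (at z within W)" "\<forall>c w. D' (s c w) = c * D' w"
    using assms(2) z unfolding complex_differentiable_on_def by blast
  show "\<exists>D. ((\<lambda>z. f z + g z) has_derivative D) (at z within W) \<and> (\<forall>c w. D (s c w) = c * D w)"
    using D(2) D'(2) has_derivative_add[OF D(1) D'(1)]
    by (intro exI[of _ "\<lambda>w. D w + D' w"]) (simp add: algebra_simps)
qed

lemma complex_differentiable_on_mult:
  fixes f g :: "_ \<Rightarrow> complex"
  assumes "complex_differentiable_on s (*) W f" "complex_differentiable_on s (*) W g"
  shows "complex_differentiable_on s (*) W (\<lambda>z. f z * g z)"
  unfolding complex_differentiable_on_def
proof
  fix z assume z: "z \<in> W"
  obtain D where D: "(f has_derivative D) (at z within W)" "\<forall>c w. D (s c w) = c * D w"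
    using assms(1) z unfolding complex_differentiable_on_def by blast
  obtain D' where D': "(g has_derivative D') (at z within W)" "\<forall>c w. D' (s c w) = c * D' w"
    using assms(2) z unfolding complex_differentiable_on_def by blast
  show "\<exists>D. ((\<lambda>z. f z * g z) has_derivative D) (at z within W) \<and> (\<forall>c w. D (s c w) = c * D w)"
    using D(2) D'(2) has_derivative_mult[OF D(1) D'(1)]
    by (intro exI[of _ "\<lambda>w. f z * D' w + D w * g z"]) (simp add: algebra_simps)
qed

text \<open>Restricting to a complex line reduces statements in several variables to one variable.\<close>

lemma holomorphic_on_complex_line:
  fixes f :: "complex ^ 'n::finite \<Rightarrow> complex"
  assumes f: "complex_differentiable_on (*s) (*) W f" and Z: "open Z"
    and W: "\<And>z. z \<in> Z \<Longrightarrow> a + z *s b \<in> W"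
  shows "(\<lambda>z. f (a + z *s b)) holomorphic_on Z"
proof -
  have "linear (\<lambda>w::complex. w *s b)"
    by (rule linearI) (simp_all add: vec_eq_iff algebra_simps)
  then have bl: "bounded_linear (\<lambda>w::complex. w *s b)"
    by (simp add: linear_conv_bounded_linear)
  have "complex_differentiable_on (*) (*s) Z (\<lambda>z. a + z *s b)"
    unfolding complex_differentiable_on_def
  proof
    fix z
    have "((\<lambda>z. a + z *s b) has_derivative (\<lambda>w. w *s b)) (at z within Z)"
      using has_derivative_add[OF has_derivative_const bounded_linear_imp_has_derivative[OF bl]]
      by fastforce
    then show "\<exists>D. ((\<lambda>z. a + z *s b) has_derivative D) (at z within Z) \<and> (\<forall>c w. D (c * w) = c *s D w)"
      by (intro exI[of _ "\<lambda>w. w *s b"]) (simp add: vec_eq_iff)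
  qed
  then have *: "complex_differentiable_on (*) (*) Z (\<lambda>z. f (a + z *s b))"
    by (rule complex_differentiable_on_compose[OF _ f]) (use W in auto)
  show ?thesis
    unfolding holomorphic_on_def
  proof
    fix z assume "z \<in> Z"
    then obtain D where D: "((\<lambda>z. f (a + z *s b)) has_derivative D) (at z within Z)"
        "\<forall>c w. D (c * w) = c * D w"
      using * unfolding complex_differentiable_on_def by blast
    have "D = (*) (D 1)"
    proof
      fix w
      show "D w = D 1 * w" using D(2)[rule_format, of w 1] by simp
    qed
    then show "(\<lambda>z. f (a + z *s b)) field_differentiable at z within Z"
      using D(1) unfolding field_differentiable_def has_field_derivative_def by metis
  qed
qed

text \<open>
  Near a point where \<open>f\<close> does not vanish the function \<open>g\<close> is zero,
  hence it is zero on the whole connected set by the identity theorem.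
\<close>

lemma holomorphic_product_zero:
  fixes f g :: "complex \<Rightarrow> complex"
  assumes "f holomorphic_on Z" "g holomorphic_on Z" "open Z" "connected Z"
    and "\<And>z. z \<in> Z \<Longrightarrow> f z * g z = 0" and "a \<in> Z" "f a \<noteq> 0" "b \<in> Z"
  shows "g b = 0"
proof -
  have "open {z \<in> Z. f z \<noteq> 0}"
    using continuous_open_preimage[OF holomorphic_on_imp_continuous_on[OF assms(1)] \<open>open Z\<close>, of "- {0}"]
    by (simp add: vimage_def Int_def open_Compl)
  moreover have "a \<in> {z \<in> Z. f z \<noteq> 0}" using assms by simp
  ultimately have lim: "a islimpt {z \<in> Z. f z \<noteq> 0}"
    by (rule interior_limit_point[OF interiorI]) auto
  have "g z = 0" if "z \<in> {z \<in> Z. f z \<noteq> 0}" for z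
    using that assms(5)[of z] by simp
  then show ?thesis
    by (intro analytic_continuation[OF assms(2-4) _ assms(6) lim _ assms(8)]) auto
qed

text \<open>
  The complex line through \<open>a\<close> and \<open>b\<close> meets the convex set
  \<open>B\<close> in a convex, hence connected, open part of the line, and it stays in the
  subspace \<open>E\<close>. Restricted to it, \<open>f\<close> and \<open>g\<close> are
  functions of one variable.
\<close>

lemma complex_differentiable_product_zero:
  fixes f g :: "complex ^ 'n::finite \<Rightarrow> complex"
  assumes E: "vec.subspace E" and B: "open B" "convex B"
    and f: "complex_differentiable_on (*s) (*) (E \<inter> B) f"
    and g: "complex_differentiable_on (*s) (*) (E \<inter> B) g"
    and fg: "\<And>z. z \<in> E \<inter> B \<Longrightarrow> f z * g z = 0"
    and a: "a \<in> E \<inter> B" "f a \<noteq> 0" and b: "b \<in> E \<inter> B"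
  shows "g b = 0"
proof -
  define Z where "Z = {z::complex. a + z *s (b - a) \<in> B}"
  have "linear (\<lambda>w::complex. w *s (b - a))"
    by (rule linearI) (simp_all add: vec_eq_iff algebra_simps)
  then have lin: "linear (\<lambda>w::complex. w *s (b - a))" and
    bl: "bounded_linear (\<lambda>w::complex. w *s (b - a))"
    by (simp_all add: linear_conv_bounded_linear)
  have "Z = (\<lambda>z. a + z *s (b - a)) -` B" by (auto simp: Z_def)
  moreover have "continuous_on UNIV (\<lambda>z::complex. a + z *s (b - a))"
    by (intro continuous_intros linear_continuous_on bl)
  ultimately have oZ: "open Z" using B(1) by (simp add: open_vimage)
  have "Z = (\<lambda>z. z *s (b - a)) -` ((\<lambda>x. - a + x) ` B)"
  proof (rule Set.set_eqI)
    fix z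
    have "a + z *s (b - a) \<in> B \<longleftrightarrow> - a + (a + z *s (b - a)) \<in> (\<lambda>x. - a + x) ` B"
      by (subst inj_image_mem_iff) (auto intro: injI)
    then show "z \<in> Z \<longleftrightarrow> z \<in> (\<lambda>z. z *s (b - a)) -` ((\<lambda>x. - a + x) ` B)"
      by (simp add: Z_def)
  qed
  then have cZ: "convex Z"
    using B(2) lin by (simp only:) (intro convex_linear_vimage convex_translation)
  have in_EB: "a + z *s (b - a) \<in> E \<inter> B" if "z \<in> Z" for z
    using that a b E unfolding Z_def
    by (auto intro!: vec.subspace_add vec.subspace_scale vec.subspace_diff)
  have "g (a + 1 *s (b - a)) = 0"
  proof (rule holomorphic_product_zero[of "\<lambda>z. f (a + z *s (b - a))" Z "\<lambda>z. g (a + z *s (b - a))" 0 1])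
    show "(\<lambda>z. f (a + z *s (b - a))) holomorphic_on Z" "(\<lambda>z. g (a + z *s (b - a))) holomorphic_on Z"
      by (rule holomorphic_on_complex_line[OF f oZ in_EB] holomorphic_on_complex_line[OF g oZ in_EB]; assumption)+
    show "connected Z" by (rule convex_connected[OF cZ])
    show "f (a + z *s (b - a)) * g (a + z *s (b - a)) = 0" if "z \<in> Z" for z
      by (rule fg[OF in_EB[OF that]])
  qed (use a b oZ in \<open>auto simp: Z_def\<close>)
  then show ?thesis by simp
qed

section \<open>Holomorphic functions on a complex manifold\<close>

locale complex_manifold =
  fixes E :: "(complex ^ 'n::finite) set" and \<Phi> :: "('a::t2_space, complex ^ 'n) atlas"
  assumes atlas: "complex_atlas E \<Phi>"
begin

lemma subspace_model: "vec.subspace E"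
  using atlas unfolding complex_atlas_def by blast

lemma chart_at: obtains U \<phi> where "(U, \<phi>) \<in> \<Phi>" "x \<in> U"
proof -
  have "x \<in> (\<Union>(U, \<phi>)\<in>\<Phi>. U)"
    using atlas unfolding complex_atlas_def by simp
  then show ?thesis using that by auto
qed

lemma
  assumes "(U, \<phi>) \<in> \<Phi>"
  shows chart_open: "open U"
    and chart_image_open: "openin (top_of_set E) (\<phi> ` U)"
    and chart_homeomorphism: "homeomorphism U (\<phi> ` U) \<phi> (inv_into U \<phi>)"
  using atlas assms unfolding complex_atlas_def by blast+

lemma chart_inv: "(U, \<phi>) \<in> \<Phi> \<Longrightarrow> p \<in> U \<Longrightarrow> inv_into U \<phi> (\<phi> p) = p"
  using homeomorphism_apply1[OF chart_homeomorphism] by blast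

lemma chart_inj: "(U, \<phi>) \<in> \<Phi> \<Longrightarrow> inj_on \<phi> U"
  by (rule inj_on_inverseI) (rule chart_inv)

text \<open>
  For arbitrary \<open>S\<close>, restricting the image of \<open>U \<inter> S\<close> to an
  open set of the manifold amounts to intersecting it with an open set \<open>G\<close> of the
  surrounding vector space; the same \<open>G\<close> serves all \<open>S\<close>. This turns
  local statements on the manifold into local statements in the model space.
\<close>

lemma chart_image_Int_open:
  assumes U: "(U, \<phi>) \<in> \<Phi>" and T: "open T"
  obtains G where "open G" "\<And>S. \<phi> ` (U \<inter> S \<inter> T) = \<phi> ` (U \<inter> S) \<inter> G"
proof -
  have "openin (top_of_set (\<phi> ` U)) (\<phi> ` (U \<inter> T))"
    using homeomorphism_imp_open_map[OF chart_homeomorphism[OF U]] T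
    by (simp add: openin_open_Int)
  then obtain G where G: "open G" "\<phi> ` (U \<inter> T) = \<phi> ` U \<inter> G"
    by (auto simp: openin_open)
  have "\<phi> ` (U \<inter> S \<inter> T) = \<phi> ` (U \<inter> S) \<inter> G" for S
  proof -
    have "\<phi> ` (U \<inter> S \<inter> T) = \<phi> ` (U \<inter> S) \<inter> \<phi> ` (U \<inter> T)"
      by (subst inj_on_image_Int[OF chart_inj[OF U], symmetric]) (auto simp: Int_ac)
    then show ?thesis using G(2) by auto
  qed
  with G(1) show ?thesis by (rule that)
qed

lemma holo_onI:
  "(\<And>U \<phi>. (U, \<phi>) \<in> \<Phi> \<Longrightarrow> complex_differentiable_on (*s) (*) (\<phi> ` (U \<inter> S)) (\<lambda>z. f (inv_into U \<phi> z)))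
    \<Longrightarrow> holo_on \<Phi> S f"
  unfolding holo_on_def o_def by auto

lemma holo_onD:
  "holo_on \<Phi> S f \<Longrightarrow> (U, \<phi>) \<in> \<Phi> \<Longrightarrow>
    complex_differentiable_on (*s) (*) (\<phi> ` (U \<inter> S)) (\<lambda>z. f (inv_into U \<phi> z))"
  unfolding holo_on_def o_def by auto

lemma holo_on_subset:
  assumes "holo_on \<Phi> S f" "T \<subseteq> S"
  shows "holo_on \<Phi> T f"
proof (rule holo_onI)
  fix U \<phi> assume "(U, \<phi>) \<in> \<Phi>"
  from holo_onD[OF assms(1) this]
  show "complex_differentiable_on (*s) (*) (\<phi> ` (U \<inter> T)) (\<lambda>z. f (inv_into U \<phi> z))"
    by (rule complex_differentiable_on_subset) (use assms(2) in auto)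
qed

lemma holo_on_const: "holo_on \<Phi> S (\<lambda>y. c)"
  by (intro holo_onI complex_differentiable_on_const)

lemma holo_on_add: "holo_on \<Phi> S f \<Longrightarrow> holo_on \<Phi> S g \<Longrightarrow> holo_on \<Phi> S (\<lambda>y. f y + g y)"
  by (rule holo_onI, rule complex_differentiable_on_add; erule (1) holo_onD)

lemma holo_on_mult: "holo_on \<Phi> S f \<Longrightarrow> holo_on \<Phi> S g \<Longrightarrow> holo_on \<Phi> S (\<lambda>y. f y * g y)"
  by (rule holo_onI, rule complex_differentiable_on_mult; erule (1) holo_onD)

lemma holo_on_uminus:
  assumes "holo_on \<Phi> S f"
  shows "holo_on \<Phi> S (\<lambda>y. - f y)"
  using holo_on_mult[OF holo_on_const[of S "-1"] assms] by simp

lemma holo_on_diff: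
  assumes "holo_on \<Phi> S f" "holo_on \<Phi> S g"
  shows "holo_on \<Phi> S (\<lambda>y. f y - g y)"
  using holo_on_add[OF assms(1) holo_on_uminus[OF assms(2)]] by simp

text \<open>
  Near a point \<open>p\<close> the function is, in a chart, the composition of \<open>F\<close>
  read in charts around \<open>p\<close> and \<open>F p\<close> with \<open>f\<close> read in
  the chart around \<open>F p\<close>.
\<close>

lemma holo_on_pullback:
  assumes F: "holomorphic_map (*s) (*s) \<Phi> \<Phi> F" and f: "holo_on \<Phi> S f"
  shows "holo_on \<Phi> (F -` S) (\<lambda>x. f (F x))"
proof (rule holo_onI)
  fix U \<phi> assume U: "(U, \<phi>) \<in> \<Phi>"
  show "complex_differentiable_on (*s) (*) (\<phi> ` (U \<inter> F -` S)) (\<lambda>z. f (F (inv_into U \<phi> z)))"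
  proof (rule complex_differentiable_on_local)
    fix z assume "z \<in> \<phi> ` (U \<inter> F -` S)"
    then obtain p where p: "p \<in> U" "F p \<in> S" "z = \<phi> p" by auto
    obtain W \<psi> where W: "(W, \<psi>) \<in> \<Phi>" "F p \<in> W" by (rule chart_at)
    have "open (F -` W)"
      using F chart_open[OF W(1)] unfolding holomorphic_map_def by (simp add: open_vimage)
    then obtain G where G: "open G" "\<And>S. \<phi> ` (U \<inter> S \<inter> F -` W) = \<phi> ` (U \<inter> S) \<inter> G"
      using chart_image_Int_open[OF U] by blast
    have "z \<in> \<phi> ` (U \<inter> F -` S \<inter> F -` W)" using p W by auto
    then have z: "z \<in> G" using G(2) by blast
    have "complex_differentiable_on (*s) (*s) (\<phi> ` (U \<inter> F -` W)) (\<psi> \<circ> F \<circ> inv_into U \<phi>)"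
      using F U W(1) unfolding holomorphic_map_def by blast
    then have 1: "complex_differentiable_on (*s) (*s) (\<phi> ` (U \<inter> F -` S \<inter> F -` W)) (\<psi> \<circ> F \<circ> inv_into U \<phi>)"
      by (rule complex_differentiable_on_subset) auto
    have 2: "complex_differentiable_on (*s) (*) (\<psi> ` (W \<inter> S)) (\<lambda>z. f (inv_into W \<psi> z))"
      by (rule holo_onD[OF f W(1)])
    have "complex_differentiable_on (*s) (*) (\<phi> ` (U \<inter> F -` S \<inter> F -` W))
        (\<lambda>z. f (inv_into W \<psi> ((\<psi> \<circ> F \<circ> inv_into U \<phi>) z)))"
      by (rule complex_differentiable_on_compose[OF 1 2]) (auto simp: chart_inv[OF U])
    then have "complex_differentiable_on (*s) (*) (\<phi> ` (U \<inter> F -` S \<inter> F -` W)) (\<lambda>z. f (F (inv_into U \<phi> z)))"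
      by (rule complex_differentiable_on_cong) (auto simp: chart_inv[OF U] chart_inv[OF W(1)])
    then show "\<exists>G. open G \<and> z \<in> G \<and>
        complex_differentiable_on (*s) (*) (\<phi> ` (U \<inter> F -` S) \<inter> G) (\<lambda>z. f (F (inv_into U \<phi> z)))"
      using G z by metis
  qed
qed

lemma holo_near_global: "holo_on \<Phi> UNIV f \<Longrightarrow> holo_near \<Phi> x f"
  unfolding holo_near_def by blast

lemma holo_near_const: "holo_near \<Phi> x (\<lambda>y. c)"
  by (rule holo_near_global[OF holo_on_const])

lemma holo_near_common:
  assumes "holo_near \<Phi> x f" "holo_near \<Phi> x g"
  obtains S where "open S" "x \<in> S" "holo_on \<Phi> S f" "holo_on \<Phi> S g"
proof -
  obtain S T where "open S" "x \<in> S" "holo_on \<Phi> S f" "open T" "x \<in> T" "holo_on \<Phi> T g"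
    using assms unfolding holo_near_def by blast
  then show ?thesis
    by (intro that[of "S \<inter> T"]) (auto intro: holo_on_subset)
qed

lemma holo_near_add: "holo_near \<Phi> x f \<Longrightarrow> holo_near \<Phi> x g \<Longrightarrow> holo_near \<Phi> x (\<lambda>y. f y + g y)"
  by (elim holo_near_common[of x f g]) (auto simp: holo_near_def intro: holo_on_add)

lemma holo_near_mult: "holo_near \<Phi> x f \<Longrightarrow> holo_near \<Phi> x g \<Longrightarrow> holo_near \<Phi> x (\<lambda>y. f y * g y)"
  by (elim holo_near_common[of x f g]) (auto simp: holo_near_def intro: holo_on_mult)

lemma holo_near_uminus:
  assumes "holo_near \<Phi> x f"
  shows "holo_near \<Phi> x (\<lambda>y. - f y)"
  using holo_near_mult[OF holo_near_const[of x "-1"] assms] by simp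

lemma holo_near_diff:
  assumes "holo_near \<Phi> x f" "holo_near \<Phi> x g"
  shows "holo_near \<Phi> x (\<lambda>y. f y - g y)"
  using holo_near_add[OF assms(1) holo_near_uminus[OF assms(2)]] by simp

lemma holo_near_pullback:
  assumes F: "holomorphic_map (*s) (*s) \<Phi> \<Phi> F" and f: "holo_near \<Phi> (F x) f"
  shows "holo_near \<Phi> x (\<lambda>x. f (F x))"
proof -
  obtain S where S: "open S" "F x \<in> S" "holo_on \<Phi> S f" using f unfolding holo_near_def by blast
  have "open (F -` S)"
    using F S(1) unfolding holomorphic_map_def by (simp add: open_vimage)
  then show ?thesis using S holo_on_pullback[OF F S(3)] unfolding holo_near_def by blast
qed

text \<open>
  In a chart, take a ball around the image of \<open>x\<close> on which the product vanishes. If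
  neither germ were zero, the ball would contain points where \<open>f\<close>, respectively
  \<open>g\<close>, is nonzero, which is impossible on the line joining them.
\<close>

lemma holo_germs_no_zero_divisors:
  assumes f: "holo_near \<Phi> x f" and g: "holo_near \<Phi> x g"
    and fg: "\<forall>\<^sub>F y in nhds x. f y * g y = 0"
  shows "(\<forall>\<^sub>F y in nhds x. f y = 0) \<or> (\<forall>\<^sub>F y in nhds x. g y = 0)"
proof -
  obtain S0 where S0: "open S0" "x \<in> S0" "holo_on \<Phi> S0 f" "holo_on \<Phi> S0 g"
    using holo_near_common[OF f g] by blast
  obtain S1 where S1: "open S1" "x \<in> S1" "\<And>y. y \<in> S1 \<Longrightarrow> f y * g y = 0"
    using fg unfolding eventually_nhds by blast
  define S where "S = S0 \<inter> S1"
  have S: "open S" "x \<in> S" "holo_on \<Phi> S f" "holo_on \<Phi> S g" "\<And>y. y \<in> S \<Longrightarrow> f y * g y = 0"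
    using S0 S1 by (auto simp: S_def intro: holo_on_subset)
  obtain U \<phi> where U: "(U, \<phi>) \<in> \<Phi>" "x \<in> U" by (rule chart_at)
  obtain G where G: "open G" "\<And>T. \<phi> ` (U \<inter> T \<inter> S) = \<phi> ` (U \<inter> T) \<inter> G"
    using chart_image_Int_open[OF U(1) S(1)] by blast
  obtain H where H: "open H" "\<phi> ` U = E \<inter> H"
    using chart_image_open[OF U(1)] by (auto simp: openin_open)
  have im: "\<phi> ` (U \<inter> S) = E \<inter> (H \<inter> G)"
    using G(2)[of UNIV] H(2) by auto
  then have "\<phi> x \<in> H \<inter> G" using U(2) S(2) by blast
  then obtain r where r: "r > 0" "ball (\<phi> x) r \<subseteq> H \<inter> G"
    using open_contains_ball[of "H \<inter> G"] open_Int[OF H(1) G(1)] by meson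
  define B where "B = ball (\<phi> x) r"
  have EB: "E \<inter> B \<subseteq> \<phi> ` (U \<inter> S)" using r im by (auto simp: B_def)
  define N where "N = U \<inter> \<phi> -` B"
  have "open N"
    unfolding N_def
    by (rule continuous_open_preimage[OF homeomorphism_cont1[OF chart_homeomorphism[OF U(1)]] chart_open[OF U(1)]])
       (simp add: B_def)
  moreover have "x \<in> N" using U r by (simp add: N_def B_def)
  ultimately have N: "eventually (\<lambda>y. y \<in> N) (nhds x)" by (rule eventually_nhds_in_open)
  have chart_N: "\<phi> p \<in> E \<inter> B" "inv_into U \<phi> (\<phi> p) = p" if "p \<in> N" for p
    using that H(2) chart_inv[OF U(1)] by (auto simp: N_def)
  have diff: "complex_differentiable_on (*s) (*) (E \<inter> B) (\<lambda>z. h (inv_into U \<phi> z))" if "holo_on \<Phi> S h" for h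
    using holo_onD[OF that U(1)] EB by (rule complex_differentiable_on_subset)
  show ?thesis
  proof (rule ccontr)
    assume neg: "\<not> ?thesis"
    have "\<exists>p\<in>N. h p \<noteq> 0" if "\<not> (\<forall>\<^sub>F y in nhds x. h y = 0)" for h :: "'a \<Rightarrow> complex"
      using that eventually_mono[OF N, of "\<lambda>y. h y = 0"] by blast
    with neg obtain p q where p: "p \<in> N" "f p \<noteq> 0" and q: "q \<in> N" "g q \<noteq> 0"
      by blast
    have "g (inv_into U \<phi> (\<phi> q)) = 0"
    proof (rule complex_differentiable_product_zero[OF subspace_model _ _ diff[OF S(3)] diff[OF S(4)]])
      show "open B" "convex B" by (simp_all add: B_def)
      show "f (inv_into U \<phi> z) * g (inv_into U \<phi> z) = 0" if z: "z \<in> E \<inter> B" for z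
      proof -
        obtain p where "p \<in> U" "p \<in> S" "z = \<phi> p" using z EB by blast
        then show ?thesis using S(5)[of p] chart_inv[OF U(1)] by simp
      qed
      show "\<phi> p \<in> E \<inter> B" "\<phi> q \<in> E \<inter> B" "f (inv_into U \<phi> (\<phi> p)) \<noteq> 0"
        using chart_N[OF p(1)] chart_N[OF q(1)] p(2) by auto
    qed
    then show False using chart_N[OF q(1)] q(2) by simp
  qed
qed

end

section \<open>Translations on a complex Lie group\<close>

locale complex_lie = 
  fixes V :: "'a::t2_space monoid" and E :: "(complex ^ 'n::finite) set"
    and \<Phi> :: "('a, complex ^ 'n) atlas"
  assumes lie: "complex_lie_group V E \<Phi>"

sublocale complex_lie \<subseteq> complex_manifold E \<Phi>
  using lie by unfold_locales (simp add: complex_lie_group_def)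

sublocale complex_lie \<subseteq> V: group V
  using lie by (simp add: complex_lie_group_def)

context complex_lie
begin

lemma carrier_V [simp]: "carrier V = UNIV"
  using lie by (simp add: complex_lie_group_def)

text \<open>
  Multiplication is holomorphic on the product manifold, and left translation is its restriction
  to a slice; in charts this is composition with \<open>w \<mapsto> (\<alpha> a, w)\<close>.
\<close>

lemma holomorphic_left_translation: "holomorphic_map (*s) (*s) \<Phi> \<Phi> (\<lambda>x. a \<otimes>\<^bsub>V\<^esub> x)"
proof -
  define m where "m = (\<lambda>(x, y). x \<otimes>\<^bsub>V\<^esub> y)"
  have m: "holomorphic_map (\<lambda>c. map_prod ((*s) c) ((*s) c)) (*s) (product_atlas \<Phi> \<Phi>) \<Phi> m"
    using lie by (simp add: complex_lie_group_def m_def)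
  have "continuous_on UNIV (\<lambda>x. m (a, x))"
    by (rule continuous_on_compose2[of UNIV m])
      (use m in \<open>auto simp: holomorphic_map_def intro!: continuous_intros\<close>)
  then have cont: "continuous_on UNIV (\<lambda>x. a \<otimes>\<^bsub>V\<^esub> x)" by (simp add: m_def)
  show ?thesis
    unfolding holomorphic_map_def
  proof (intro conjI cont ballI, clarify)
    fix U \<phi> W \<psi> assume U: "(U, \<phi>) \<in> \<Phi>" and W: "(W, \<psi>) \<in> \<Phi>"
    obtain A \<alpha> where A: "(A, \<alpha>) \<in> \<Phi>" "a \<in> A" by (rule chart_at)
    let ?T = "\<phi> ` (U \<inter> (\<lambda>x. a \<otimes>\<^bsub>V\<^esub> x) -` W)"
    let ?P = "map_prod \<alpha> \<phi> ` (A \<times> U \<inter> m -` W)"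
    have inv: "inv_into (A \<times> U) (map_prod \<alpha> \<phi>) (\<alpha> a, \<phi> p) = (a, p)" if "p \<in> U" for p
      using inv_into_f_f[OF map_prod_inj_on[OF chart_inj[OF A(1)] chart_inj[OF U]], of "(a, p)"]
        that A(2) by simp
    have 1: "complex_differentiable_on (*s) (\<lambda>c. map_prod ((*s) c) ((*s) c)) ?T (\<lambda>w. (\<alpha> a, w))"
      unfolding complex_differentiable_on_def
      by (auto intro!: exI[of _ "\<lambda>w. (0, w)"] derivative_intros simp: map_prod_def)
    have "(A \<times> U, map_prod \<alpha> \<phi>) \<in> product_atlas \<Phi> \<Phi>"
      using A(1) U unfolding product_atlas_def by blast
    then have 2: "complex_differentiable_on (\<lambda>c. map_prod ((*s) c) ((*s) c)) (*s) ?P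
        (\<psi> \<circ> m \<circ> inv_into (A \<times> U) (map_prod \<alpha> \<phi>))"
      using m W unfolding holomorphic_map_def by blast
    have "complex_differentiable_on (*s) (*s) ?T
        (\<lambda>w. (\<psi> \<circ> m \<circ> inv_into (A \<times> U) (map_prod \<alpha> \<phi>)) (\<alpha> a, w))"
    proof (rule complex_differentiable_on_compose[OF 1 2], clarify)
      fix p assume "p \<in> U" "a \<otimes>\<^bsub>V\<^esub> p \<in> W"
      then show "(\<alpha> a, \<phi> p) \<in> ?P" using A(2) by (intro image_eqI[of _ _ "(a, p)"]) (auto simp: m_def)
    qed
    then show "complex_differentiable_on (*s) (*s) ?T (\<psi> \<circ> (\<lambda>x. a \<otimes>\<^bsub>V\<^esub> x) \<circ> inv_into U \<phi>)"
      by (rule complex_differentiable_on_cong) (auto simp: inv chart_inv[OF U] m_def)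
  qed
qed

lemma holo_near_translate:
  "holo_near \<Phi> (a \<otimes>\<^bsub>V\<^esub> x) f \<Longrightarrow> holo_near \<Phi> x (\<lambda>x. f (a \<otimes>\<^bsub>V\<^esub> x))"
  by (rule holo_near_pullback[OF holomorphic_left_translation])

lemma eventually_translate:
  assumes "\<forall>\<^sub>F y in nhds (a \<otimes>\<^bsub>V\<^esub> x). P y"
  shows "\<forall>\<^sub>F y in nhds x. P (a \<otimes>\<^bsub>V\<^esub> y)"
proof -
  have "continuous_on UNIV (\<lambda>x. a \<otimes>\<^bsub>V\<^esub> x)"
    using holomorphic_left_translation unfolding holomorphic_map_def by blast
  then have "((\<lambda>x. a \<otimes>\<^bsub>V\<^esub> x) \<longlongrightarrow> a \<otimes>\<^bsub>V\<^esub> x) (nhds x)"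
    by (simp add: continuous_on_eq_continuous_at isCont_def tendsto_at_iff_tendsto_nhds)
  then show ?thesis using assms by (rule eventually_compose_filterlim[rotated])
qed

end

section \<open>Stalks\<close>

context complex_manifold
begin

text \<open>
  Membership of a pair in the set on which \<open>frac_rel\<close> is an equivalence relation.
\<close>

definition fraction_at :: "'a \<Rightarrow> ('a \<Rightarrow> complex) \<Rightarrow> ('a \<Rightarrow> complex) \<Rightarrow> bool"
where
  "fraction_at x g h \<longleftrightarrow> holo_near \<Phi> x g \<and> holo_near \<Phi> x h \<and> \<not> (\<forall>\<^sub>F y in nhds x. h y = 0)"

abbreviation holo_germ :: "'a \<Rightarrow> ('a \<Rightarrow> complex) \<Rightarrow> 'a mgerm"
where
  "holo_germ x g \<equiv> quot_germ \<Phi> x g (\<lambda>y. 1)"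

abbreviation stalk :: "'a \<Rightarrow> 'a mgerm ring"
where
  "stalk x \<equiv> mero_stalk \<Phi> x"

lemma fraction_at_one_iff [simp]: "fraction_at x g (\<lambda>y. 1) \<longleftrightarrow> holo_near \<Phi> x g"
  by (simp add: fraction_at_def holo_near_const)

lemma fraction_at_mult:
  assumes "fraction_at x g h" "fraction_at x g' h'"
  shows "fraction_at x (\<lambda>y. g y * g' y) (\<lambda>y. h y * h' y)"
  using assms holo_germs_no_zero_divisors[of x h h'] unfolding fraction_at_def
  by (auto intro!: holo_near_mult)

lemma fraction_at_add:
  assumes "fraction_at x g h" "fraction_at x g' h'"
  shows "fraction_at x (\<lambda>y. g y * h' y + g' y * h y) (\<lambda>y. h y * h' y)"
  using assms holo_germs_no_zero_divisors[of x h h'] unfolding fraction_at_def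
  by (auto intro!: holo_near_mult holo_near_add)

lemma fraction_at_uminus: "fraction_at x g h \<Longrightarrow> fraction_at x (\<lambda>y. - g y) h"
  unfolding fraction_at_def by (auto intro!: holo_near_uminus)

lemma frac_rel_iff:
  "((g, h), (g', h')) \<in> frac_rel \<Phi> x \<longleftrightarrow>
    fraction_at x g h \<and> fraction_at x g' h' \<and> (\<forall>\<^sub>F y in nhds x. g y * h' y = g' y * h y)"
  unfolding frac_rel_def fraction_at_def by auto

lemma fraction_cross_trans:
  fixes g h g' h' g'' h'' :: complex
  assumes "g * h' = g' * h" "g' * h'' = g'' * h'"
  shows "h' * (g * h'' - g'' * h) = 0"
proof -
  have "h' * (g * h'' - g'' * h) = (g * h') * h'' - (g'' * h') * h" by (simp add: algebra_simps)
  also have "\<dots> = (g' * h) * h'' - (g' * h'') * h" by (simp only: assms)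
  finally show ?thesis by (simp add: algebra_simps)
qed

lemma fraction_cross_mult:
  fixes g h g1 h1 g' h' g1' h1' :: complex
  assumes "g * h1 = g1 * h" "g' * h1' = g1' * h'"
  shows "g1 * g1' * (h * h') = g * g' * (h1 * h1')"
proof -
  have "g1 * g1' * (h * h') = (g1 * h) * (g1' * h')" by (simp add: algebra_simps)
  also have "\<dots> = (g * h1) * (g' * h1')" by (simp only: assms)
  finally show ?thesis by (simp add: algebra_simps)
qed

lemma fraction_cross_add:
  fixes g h g1 h1 g' h' g1' h1' :: complex
  assumes "g * h1 = g1 * h" "g' * h1' = g1' * h'"
  shows "(g1 * h1' + g1' * h1) * (h * h') = (g * h' + g' * h) * (h1 * h1')"
proof -
  have "(g1 * h1' + g1' * h1) * (h * h') = (g1 * h) * (h1' * h') + (g1' * h') * (h1 * h)"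
    by (simp add: algebra_simps)
  also have "\<dots> = (g * h1) * (h1' * h') + (g' * h1') * (h1 * h)" by (simp only: assms)
  finally show ?thesis by (simp add: algebra_simps)
qed

text \<open>
  Transitivity cancels the middle denominator, whose germ is nonzero; this is legitimate because
  germs have no zero divisors.
\<close>

lemma equiv_frac_rel: "equiv {(g, h). fraction_at x g h} (frac_rel \<Phi> x)"
proof (rule equivI)
  show "frac_rel \<Phi> x \<subseteq> {(g, h). fraction_at x g h} \<times> {(g, h). fraction_at x g h}"
    by (auto simp: frac_rel_iff)
  show "refl_on {(g, h). fraction_at x g h} (frac_rel \<Phi> x)"
    by (auto simp: refl_on_def frac_rel_iff)
  show "sym (frac_rel \<Phi> x)"
    by (auto simp: sym_def frac_rel_iff elim: eventually_mono)
  show "trans (frac_rel \<Phi> x)"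
  proof (rule transI, clarify)
    fix g h g' h' g'' h''
    assume "((g, h), (g', h')) \<in> frac_rel \<Phi> x" "((g', h'), (g'', h'')) \<in> frac_rel \<Phi> x"
    then have f: "fraction_at x g h" "fraction_at x g' h'" "fraction_at x g'' h''"
      and e: "\<forall>\<^sub>F y in nhds x. g y * h' y = g' y * h y" "\<forall>\<^sub>F y in nhds x. g' y * h'' y = g'' y * h' y"
      by (auto simp: frac_rel_iff)
    have "\<forall>\<^sub>F y in nhds x. h' y * (g y * h'' y - g'' y * h y) = 0"
      using e by eventually_elim (rule fraction_cross_trans)
    moreover have "holo_near \<Phi> x h'" "holo_near \<Phi> x (\<lambda>y. g y * h'' y - g'' y * h y)"
      using f by (auto simp: fraction_at_def intro!: holo_near_mult holo_near_diff)
    ultimately have "\<forall>\<^sub>F y in nhds x. g y * h'' y - g'' y * h y = 0"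
      using holo_germs_no_zero_divisors f(2) unfolding fraction_at_def by blast
    then show "((g, h), (g'', h'')) \<in> frac_rel \<Phi> x"
      using f by (simp add: frac_rel_iff)
  qed
qed

lemma quot_germ_eq_iff:
  assumes "fraction_at x g h" "fraction_at x g' h'"
  shows "quot_germ \<Phi> x g h = quot_germ \<Phi> x g' h' \<longleftrightarrow> (\<forall>\<^sub>F y in nhds x. g y * h' y = g' y * h y)"
  unfolding quot_germ_def
  using eq_equiv_class_iff[OF equiv_frac_rel, of "(g, h)" x "(g', h')"] assms
  by (simp add: frac_rel_iff)

lemma quot_germ_eqI:
  assumes "fraction_at x g h" "fraction_at x g' h'" "\<And>y. g y * h' y = g' y * h y"
  shows "quot_germ \<Phi> x g h = quot_germ \<Phi> x g' h'"
  using assms by (simp add: quot_germ_eq_iff)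

lemma carrier_stalk: "carrier (stalk x) = {quot_germ \<Phi> x g h | g h. fraction_at x g h}"
proof -
  have "Field (frac_rel \<Phi> x) = {(g, h). fraction_at x g h}"
  proof
    show "Field (frac_rel \<Phi> x) \<subseteq> {(g, h). fraction_at x g h}"
      by (auto simp: Field_def Domain_iff Range_iff frac_rel_iff)
    have "((g, h), (g, h)) \<in> frac_rel \<Phi> x" if "fraction_at x g h" for g h
      using that by (simp add: frac_rel_iff)
    then show "{(g, h). fraction_at x g h} \<subseteq> Field (frac_rel \<Phi> x)"
      by (auto intro: FieldI1)
  qed
  then show ?thesis
    unfolding mero_stalk_def quotient_def quot_germ_def by auto
qed

lemma stalkE:
  assumes "F \<in> carrier (stalk x)"
  obtains g h where "fraction_at x g h" "F = quot_germ \<Phi> x g h"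
  using assms unfolding carrier_stalk by blast

lemma quot_germ_closed: "fraction_at x g h \<Longrightarrow> quot_germ \<Phi> x g h \<in> carrier (stalk x)"
  unfolding carrier_stalk by blast

text \<open>
  The ring operations on stalks are unions over all representatives of both classes; when the
  summand of the union does not depend on the representatives, the union is that common value.
\<close>

lemma frac_rel_class_UN:
  assumes "fraction_at x g h" "fraction_at x g' h'"
    and "\<And>g1 h1 g1' h1'. ((g, h), (g1, h1)) \<in> frac_rel \<Phi> x \<Longrightarrow> ((g', h'), (g1', h1')) \<in> frac_rel \<Phi> x \<Longrightarrow>
      N g1 h1 g1' h1' = K"
  shows "(\<Union>(g1, h1)\<in>quot_germ \<Phi> x g h. \<Union>(g1', h1')\<in>quot_germ \<Phi> x g' h'. N g1 h1 g1' h1') = K"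
proof -
  have 1: "(g, h) \<in> quot_germ \<Phi> x g h" "(g', h') \<in> quot_germ \<Phi> x g' h'"
    using assms(1,2) by (simp_all add: quot_germ_def frac_rel_iff)
  have inner: "(\<Union>(g1', h1')\<in>quot_germ \<Phi> x g' h'. N g1 h1 g1' h1') = K"
    if "(g1, h1) \<in> quot_germ \<Phi> x g h" for g1 h1
  proof (rule UN_constant_eq[OF 1(2)], clarify)
    fix g1' h1' assume "(g1', h1') \<in> quot_germ \<Phi> x g' h'"
    then show "N g1 h1 g1' h1' = K" using that assms(3) by (simp add: quot_germ_def)
  qed
  show ?thesis
    by (rule UN_constant_eq[OF 1(1)], clarify, rule inner)
qed

lemma stalk_mult:
  assumes f: "fraction_at x g h" "fraction_at x g' h'"
  shows "quot_germ \<Phi> x g h \<otimes>\<^bsub>stalk x\<^esub> quot_germ \<Phi> x g' h' =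
    quot_germ \<Phi> x (\<lambda>y. g y * g' y) (\<lambda>y. h y * h' y)"
  unfolding mero_stalk_def monoid.simps
proof (rule frac_rel_class_UN[OF f])
  fix g1 h1 g1' h1'
  assume "((g, h), (g1, h1)) \<in> frac_rel \<Phi> x" "((g', h'), (g1', h1')) \<in> frac_rel \<Phi> x"
  then have f1: "fraction_at x g1 h1" "fraction_at x g1' h1'"
    and e: "\<forall>\<^sub>F y in nhds x. g y * h1 y = g1 y * h y" "\<forall>\<^sub>F y in nhds x. g' y * h1' y = g1' y * h' y"
    by (auto simp: frac_rel_iff)
  show "quot_germ \<Phi> x (\<lambda>y. g1 y * g1' y) (\<lambda>y. h1 y * h1' y) =
      quot_germ \<Phi> x (\<lambda>y. g y * g' y) (\<lambda>y. h y * h' y)"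
    unfolding quot_germ_eq_iff[OF fraction_at_mult[OF f1] fraction_at_mult[OF f]]
    using e by eventually_elim (rule fraction_cross_mult)
qed

lemma stalk_add:
  assumes f: "fraction_at x g h" "fraction_at x g' h'"
  shows "quot_germ \<Phi> x g h \<oplus>\<^bsub>stalk x\<^esub> quot_germ \<Phi> x g' h' =
    quot_germ \<Phi> x (\<lambda>y. g y * h' y + g' y * h y) (\<lambda>y. h y * h' y)"
  unfolding mero_stalk_def ring.simps
proof (rule frac_rel_class_UN[OF f])
  fix g1 h1 g1' h1'
  assume "((g, h), (g1, h1)) \<in> frac_rel \<Phi> x" "((g', h'), (g1', h1')) \<in> frac_rel \<Phi> x"
  then have f1: "fraction_at x g1 h1" "fraction_at x g1' h1'"
    and e: "\<forall>\<^sub>F y in nhds x. g y * h1 y = g1 y * h y" "\<forall>\<^sub>F y in nhds x. g' y * h1' y = g1' y * h' y"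
    by (auto simp: frac_rel_iff)
  show "quot_germ \<Phi> x (\<lambda>y. g1 y * h1' y + g1' y * h1 y) (\<lambda>y. h1 y * h1' y) =
      quot_germ \<Phi> x (\<lambda>y. g y * h' y + g' y * h y) (\<lambda>y. h y * h' y)"
    unfolding quot_germ_eq_iff[OF fraction_at_add[OF f1] fraction_at_add[OF f]]
    using e by eventually_elim (rule fraction_cross_add)
qed

lemma stalk_one: "\<one>\<^bsub>stalk x\<^esub> = holo_germ x (\<lambda>y. 1)"
  and stalk_zero: "\<zero>\<^bsub>stalk x\<^esub> = holo_germ x (\<lambda>y. 0)"
  by (simp_all add: mero_stalk_def)

text \<open>
  Gives the additive inverse in the stalk, also for holomorphic germs.
\<close>

lemma stalk_add_uminus:
  assumes f: "fraction_at x g h"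
  shows "quot_germ \<Phi> x (\<lambda>y. - g y) h \<oplus>\<^bsub>stalk x\<^esub> quot_germ \<Phi> x g h = \<zero>\<^bsub>stalk x\<^esub>"
  unfolding stalk_add[OF fraction_at_uminus[OF f] f] stalk_zero
  using fraction_at_add[OF fraction_at_uminus[OF f] f]
  by (intro quot_germ_eqI) (simp_all add: holo_near_const)

lemma cring_stalk: "cring (stalk x)"
proof (rule cringI)
  note simps = stalk_add stalk_mult stalk_one stalk_zero fraction_at_mult fraction_at_add
    holo_near_const
  show "abelian_group (stalk x)"
  proof (rule abelian_groupI)
    fix F G H assume F: "F \<in> carrier (stalk x)" and G: "G \<in> carrier (stalk x)" and H: "H \<in> carrier (stalk x)"
    obtain f f' where f: "fraction_at x f f'" "F = quot_germ \<Phi> x f f'" using F by (rule stalkE)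
    obtain g g' where g: "fraction_at x g g'" "G = quot_germ \<Phi> x g g'" using G by (rule stalkE)
    obtain h h' where h: "fraction_at x h h'" "H = quot_germ \<Phi> x h h'" using H by (rule stalkE)
    show "F \<oplus>\<^bsub>stalk x\<^esub> G \<oplus>\<^bsub>stalk x\<^esub> H = F \<oplus>\<^bsub>stalk x\<^esub> (G \<oplus>\<^bsub>stalk x\<^esub> H)"
      unfolding f(2) g(2) h(2) stalk_add[OF f(1) g(1)] stalk_add[OF g(1) h(1)]
        stalk_add[OF fraction_at_add[OF f(1) g(1)] h(1)] stalk_add[OF f(1) fraction_at_add[OF g(1) h(1)]]
      by (rule quot_germ_eqI) (intro fraction_at_add f(1) g(1) h(1), intro fraction_at_add f(1) g(1) h(1), simp add: algebra_simps)
  next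
    fix F assume "F \<in> carrier (stalk x)"
    then obtain g h where f: "fraction_at x g h" "F = quot_germ \<Phi> x g h" by (rule stalkE)
    then show "\<exists>G\<in>carrier (stalk x). G \<oplus>\<^bsub>stalk x\<^esub> F = \<zero>\<^bsub>stalk x\<^esub>"
      using stalk_add_uminus quot_germ_closed fraction_at_uminus by blast
  next
    show "\<zero>\<^bsub>stalk x\<^esub> \<in> carrier (stalk x)"
      by (simp add: stalk_zero quot_germ_closed holo_near_const)
  next
    fix F G assume F: "F \<in> carrier (stalk x)" and G: "G \<in> carrier (stalk x)"
    obtain f f' where f: "fraction_at x f f'" "F = quot_germ \<Phi> x f f'" using F by (rule stalkE)
    obtain g g' where g: "fraction_at x g g'" "G = quot_germ \<Phi> x g g'" using G by (rule stalkE)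
    show "F \<oplus>\<^bsub>stalk x\<^esub> G = G \<oplus>\<^bsub>stalk x\<^esub> F"
      unfolding f(2) g(2) stalk_add[OF f(1) g(1)] stalk_add[OF g(1) f(1)]
      by (simp add: mult.commute add.commute)
  qed (auto simp: simps elim!: stalkE intro!: quot_germ_closed)
  show "comm_monoid (stalk x)"
  proof (rule comm_monoidI)
    show "\<one>\<^bsub>stalk x\<^esub> \<in> carrier (stalk x)"
      by (simp add: stalk_one quot_germ_closed holo_near_const)
  qed (auto simp: simps mult_ac elim!: stalkE intro!: quot_germ_closed)
  fix F G H assume F: "F \<in> carrier (stalk x)" and G: "G \<in> carrier (stalk x)" and H: "H \<in> carrier (stalk x)"
  obtain f f' where f: "fraction_at x f f'" "F = quot_germ \<Phi> x f f'" using F by (rule stalkE)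
  obtain g g' where g: "fraction_at x g g'" "G = quot_germ \<Phi> x g g'" using G by (rule stalkE)
  obtain h h' where h: "fraction_at x h h'" "H = quot_germ \<Phi> x h h'" using H by (rule stalkE)
  show "(F \<oplus>\<^bsub>stalk x\<^esub> G) \<otimes>\<^bsub>stalk x\<^esub> H = F \<otimes>\<^bsub>stalk x\<^esub> H \<oplus>\<^bsub>stalk x\<^esub> G \<otimes>\<^bsub>stalk x\<^esub> H"
    unfolding f(2) g(2) h(2) stalk_add[OF f(1) g(1)] stalk_mult[OF fraction_at_add[OF f(1) g(1)] h(1)]
      stalk_mult[OF f(1) h(1)] stalk_mult[OF g(1) h(1)]
      stalk_add[OF fraction_at_mult[OF f(1) h(1)] fraction_at_mult[OF g(1) h(1)]]
    by (rule quot_germ_eqI) (intro fraction_at_add fraction_at_mult f(1) g(1) h(1),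
      intro fraction_at_add fraction_at_mult f(1) g(1) h(1), simp add: algebra_simps)
qed

end

text \<open>Sums of germs occur at varying base points, so the base point stays a parameter of the ring facts.\<close>

sublocale complex_manifold \<subseteq> stalk: cring "mero_stalk \<Phi> x" for x
  by (rule cring_stalk)

context complex_manifold
begin

subsection \<open>Holomorphic germs and their values\<close>

abbreviation holo_carrier :: "'a \<Rightarrow> 'a mgerm set"
where
  "holo_carrier x \<equiv> carrier (holo_stalk \<Phi> x)"

lemma holo_carrier_eq: "holo_carrier x = {holo_germ x g | g. holo_near \<Phi> x g}"
  by (simp add: holo_stalk_def)

lemma holo_stalk_simps [simp]:
  "mult (holo_stalk \<Phi> x) = mult (stalk x)" "one (holo_stalk \<Phi> x) = one (stalk x)"
  "add (holo_stalk \<Phi> x) = add (stalk x)" "zero (holo_stalk \<Phi> x) = zero (stalk x)"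
  by (simp_all add: holo_stalk_def)

lemma holo_carrierE:
  assumes "F \<in> holo_carrier x"
  obtains g where "holo_near \<Phi> x g" "F = holo_germ x g"
  using assms unfolding holo_carrier_eq by blast

lemma holo_germ_closed: "holo_near \<Phi> x g \<Longrightarrow> holo_germ x g \<in> holo_carrier x"
  unfolding holo_carrier_eq by blast

lemma holo_carrier_subset: "holo_carrier x \<subseteq> carrier (stalk x)"
  unfolding holo_carrier_eq carrier_stalk by (force simp: fraction_at_def holo_near_const)

lemma holo_in_stalk: "F \<in> holo_carrier x \<Longrightarrow> F \<in> carrier (stalk x)"
  using holo_carrier_subset by blast

lemma holo_germ_add:
  "holo_near \<Phi> x f \<Longrightarrow> holo_near \<Phi> x g \<Longrightarrow>
    holo_germ x f \<oplus>\<^bsub>stalk x\<^esub> holo_germ x g = holo_germ x (\<lambda>y. f y + g y)"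
  by (simp add: stalk_add)

lemma holo_germ_mult:
  "holo_near \<Phi> x f \<Longrightarrow> holo_near \<Phi> x g \<Longrightarrow>
    holo_germ x f \<otimes>\<^bsub>stalk x\<^esub> holo_germ x g = holo_germ x (\<lambda>y. f y * g y)"
  by (simp add: stalk_mult)

lemma holo_germ_uminus:
  assumes "holo_near \<Phi> x f"
  shows "\<ominus>\<^bsub>stalk x\<^esub> holo_germ x f = holo_germ x (\<lambda>y. - f y)"
  using assms stalk_add_uminus[of x f "\<lambda>y. 1"]
  by (intro stalk.minus_equality) (auto intro!: quot_germ_closed holo_near_uminus)

lemma subcring_holo: "subcring (holo_carrier x) (stalk x)"
proof (rule stalk.subcringI', rule stalk.subringI)
  show "holo_carrier x \<subseteq> carrier (stalk x)" by (rule holo_carrier_subset)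
  show "\<one>\<^bsub>stalk x\<^esub> \<in> holo_carrier x" by (simp add: stalk_one holo_germ_closed holo_near_const)
  fix F assume F: "F \<in> holo_carrier x"
  then show "\<ominus>\<^bsub>stalk x\<^esub> F \<in> holo_carrier x"
    by (auto elim!: holo_carrierE simp: holo_germ_uminus intro!: holo_germ_closed holo_near_uminus)
  fix G assume "G \<in> holo_carrier x"
  with F show "F \<otimes>\<^bsub>stalk x\<^esub> G \<in> holo_carrier x" "F \<oplus>\<^bsub>stalk x\<^esub> G \<in> holo_carrier x"
    by (auto elim!: holo_carrierE simp: holo_germ_mult holo_germ_add
        intro!: holo_germ_closed holo_near_mult holo_near_add)
qed

lemma cring_holo_stalk: "cring (holo_stalk \<Phi> x)"
proof -
  have "holo_stalk \<Phi> x = stalk x\<lparr>carrier := holo_carrier x\<rparr>"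
    by (simp add: holo_stalk_def)
  then show ?thesis
    using stalk.subcring_iff[OF holo_carrier_subset] subcring_holo by metis
qed

text \<open>
  Only meaningful for holomorphic germs, whose value does not depend on the representative.
\<close>

definition germ_value :: "'a \<Rightarrow> 'a mgerm \<Rightarrow> complex"
where
  "germ_value x F = (THE c. \<exists>g. holo_near \<Phi> x g \<and> F = holo_germ x g \<and> c = g x)"

lemma germ_value_holo_germ [simp]:
  assumes "holo_near \<Phi> x g"
  shows "germ_value x (holo_germ x g) = g x"
  unfolding germ_value_def
proof (rule the_equality)
  fix c assume "\<exists>g'. holo_near \<Phi> x g' \<and> holo_germ x g = holo_germ x g' \<and> c = g' x"
  then obtain g' where g': "holo_near \<Phi> x g'" "holo_germ x g = holo_germ x g'" "c = g' x" by blast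
  then have "\<forall>\<^sub>F y in nhds x. g y = g' y"
    using assms quot_germ_eq_iff[of x g "\<lambda>y. 1" g' "\<lambda>y. 1"] by simp
  then show "c = g x" using g'(3) eventually_nhds_x_imp_x by fastforce
qed (use assms in blast)

lemma germ_value_add:
  "F \<in> holo_carrier x \<Longrightarrow> G \<in> holo_carrier x \<Longrightarrow>
    germ_value x (F \<oplus>\<^bsub>stalk x\<^esub> G) = germ_value x F + germ_value x G"
  by (auto elim!: holo_carrierE simp: holo_germ_add holo_near_add)

lemma germ_value_mult:
  "F \<in> holo_carrier x \<Longrightarrow> G \<in> holo_carrier x \<Longrightarrow>
    germ_value x (F \<otimes>\<^bsub>stalk x\<^esub> G) = germ_value x F * germ_value x G"
  by (auto elim!: holo_carrierE simp: holo_germ_mult holo_near_mult)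

lemma germ_value_zero [simp]: "germ_value x \<zero>\<^bsub>stalk x\<^esub> = 0"
  and germ_value_one [simp]: "germ_value x \<one>\<^bsub>stalk x\<^esub> = 1"
  by (simp_all add: stalk_zero stalk_one holo_near_const)

lemma zero_in_holo [simp, intro]: "\<zero>\<^bsub>stalk x\<^esub> \<in> holo_carrier x"
  and one_in_holo [simp, intro]: "\<one>\<^bsub>stalk x\<^esub> \<in> holo_carrier x"
  by (simp_all add: stalk_zero stalk_one holo_germ_closed holo_near_const)

lemma vanishing_germs_eq: "vanishing_germs \<Phi> x = {F \<in> holo_carrier x. germ_value x F = 0}"
  unfolding vanishing_germs_def holo_carrier_eq by auto

lemma ideal_vanishing: "ideal (vanishing_germs \<Phi> x) (holo_stalk \<Phi> x)"
proof -
  interpret H: cring "holo_stalk \<Phi> x" by (rule cring_holo_stalk)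
  have minus: "germ_value x (\<ominus>\<^bsub>holo_stalk \<Phi> x\<^esub> F) = 0" if F: "F \<in> holo_carrier x" "germ_value x F = 0" for F
    using germ_value_add[OF F(1) H.a_inv_closed[OF F(1)]] H.r_neg[OF F(1)] F(2) by simp
  show ?thesis
  proof (rule idealI)
    show "ring (holo_stalk \<Phi> x)" by unfold_locales
    show "subgroup (vanishing_germs \<Phi> x) (add_monoid (holo_stalk \<Phi> x))"
    proof (rule H.add.subgroupI)
      show "vanishing_germs \<Phi> x \<noteq> {}" unfolding vanishing_germs_eq using zero_in_holo germ_value_zero by blast
    next
      fix F assume "F \<in> vanishing_germs \<Phi> x"
      then show "\<ominus>\<^bsub>holo_stalk \<Phi> x\<^esub> F \<in> vanishing_germs \<Phi> x"
        using minus H.a_inv_closed by (auto simp: vanishing_germs_eq)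
    next
      fix F G assume "F \<in> vanishing_germs \<Phi> x" "G \<in> vanishing_germs \<Phi> x"
      then show "F \<oplus>\<^bsub>holo_stalk \<Phi> x\<^esub> G \<in> vanishing_germs \<Phi> x"
        using H.a_closed by (auto simp: vanishing_germs_eq germ_value_add)
    qed (auto simp: vanishing_germs_eq)
  qed (use H.m_closed in \<open>auto simp: vanishing_germs_eq germ_value_mult\<close>)
qed

abbreviation residue :: "'a \<Rightarrow> 'a mgerm \<Rightarrow> 'a mgerm set"
where
  "residue x F \<equiv> vanishing_germs \<Phi> x +>\<^bsub>holo_stalk \<Phi> x\<^esub> F"

lemma residue_eq_iff:
  assumes F: "F \<in> holo_carrier x" and G: "G \<in> holo_carrier x"
  shows "residue x F = residue x G \<longleftrightarrow> germ_value x F = germ_value x G"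
proof -
  interpret H: cring "holo_stalk \<Phi> x" by (rule cring_holo_stalk)
  have D: "F \<ominus>\<^bsub>holo_stalk \<Phi> x\<^esub> G \<in> holo_carrier x" using F G by (rule H.minus_closed)
  have "F = (F \<ominus>\<^bsub>holo_stalk \<Phi> x\<^esub> G) \<oplus>\<^bsub>holo_stalk \<Phi> x\<^esub> G"
    using F G by (simp del: holo_stalk_simps add: H.minus_eq H.a_assoc H.l_neg)
  then have "germ_value x F = germ_value x (F \<ominus>\<^bsub>holo_stalk \<Phi> x\<^esub> G) + germ_value x G"
    using germ_value_add[OF D G] by simp
  then show ?thesis
    using H.quotient_eq_iff_same_a_r_cos[OF ideal_vanishing F G] D by (auto simp: vanishing_germs_eq)
qed

lemma mem_residue_iff:
  assumes G: "G \<in> holo_carrier x"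
  shows "F \<in> residue x G \<longleftrightarrow> F \<in> holo_carrier x \<and> germ_value x F = germ_value x G"
proof -
  interpret I: ideal "vanishing_germs \<Phi> x" "holo_stalk \<Phi> x" by (rule ideal_vanishing)
  have "F \<in> residue x F" if "F \<in> holo_carrier x" using that by (rule I.a_rcos_self)
  moreover have "F \<in> holo_carrier x" "residue x G = residue x F" if "F \<in> residue x G"
    using I.a_elemrcos_carrier[OF G that] I.a_repr_independence'[OF that G] by auto
  ultimately show ?thesis
    using G residue_eq_iff by metis
qed

end

section \<open>Translation of germs and sections\<close>

context complex_lie
begin

lemma inv_cancel [simp]:
  "inv\<^bsub>V\<^esub> a \<otimes>\<^bsub>V\<^esub> (a \<otimes>\<^bsub>V\<^esub> x) = x" "a \<otimes>\<^bsub>V\<^esub> (inv\<^bsub>V\<^esub> a \<otimes>\<^bsub>V\<^esub> x) = x"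
  by (simp_all add: V.m_assoc[symmetric])

lemma inv_mult_apply: "inv\<^bsub>V\<^esub> (a \<otimes>\<^bsub>V\<^esub> b) \<otimes>\<^bsub>V\<^esub> x = inv\<^bsub>V\<^esub> b \<otimes>\<^bsub>V\<^esub> (inv\<^bsub>V\<^esub> a \<otimes>\<^bsub>V\<^esub> x)"
  by (simp add: V.inv_mult_group V.m_assoc)

lemma fraction_at_translate:
  assumes "fraction_at (inv\<^bsub>V\<^esub> a \<otimes>\<^bsub>V\<^esub> y) g h"
  shows "fraction_at y (\<lambda>z. g (inv\<^bsub>V\<^esub> a \<otimes>\<^bsub>V\<^esub> z)) (\<lambda>z. h (inv\<^bsub>V\<^esub> a \<otimes>\<^bsub>V\<^esub> z))"
  using assms holo_near_translate[of "inv\<^bsub>V\<^esub> a" y]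
    eventually_translate[where P = "\<lambda>z. h (inv\<^bsub>V\<^esub> a \<otimes>\<^bsub>V\<^esub> z) = 0" and a = a and x = "inv\<^bsub>V\<^esub> a \<otimes>\<^bsub>V\<^esub> y"]
  unfolding fraction_at_def by auto

lemma frac_rel_translate:
  assumes "((g, h), (g', h')) \<in> frac_rel \<Phi> (inv\<^bsub>V\<^esub> a \<otimes>\<^bsub>V\<^esub> y)"
  shows "((\<lambda>z. g (inv\<^bsub>V\<^esub> a \<otimes>\<^bsub>V\<^esub> z), \<lambda>z. h (inv\<^bsub>V\<^esub> a \<otimes>\<^bsub>V\<^esub> z)),
    (\<lambda>z. g' (inv\<^bsub>V\<^esub> a \<otimes>\<^bsub>V\<^esub> z), \<lambda>z. h' (inv\<^bsub>V\<^esub> a \<otimes>\<^bsub>V\<^esub> z))) \<in> frac_rel \<Phi> y"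
  using assms fraction_at_translate
    eventually_translate[where P = "\<lambda>y. g y * h' y = g' y * h y" and a = "inv\<^bsub>V\<^esub> a" and x = y]
  unfolding frac_rel_iff by blast

lemma translate_germ_translate_germ:
  "translate_germ V a (translate_germ V b F) = translate_germ V (a \<otimes>\<^bsub>V\<^esub> b) F"
  unfolding translate_germ_def image_image by (simp add: inv_mult_apply case_prod_beta)

lemma translate_germ_id [simp]: "translate_germ V \<one>\<^bsub>V\<^esub> F = F"
  by (simp add: translate_germ_def)

lemma translate_quot_germ:
  assumes f: "fraction_at (inv\<^bsub>V\<^esub> a \<otimes>\<^bsub>V\<^esub> y) g h"
  shows "translate_germ V a (quot_germ \<Phi> (inv\<^bsub>V\<^esub> a \<otimes>\<^bsub>V\<^esub> y) g h) =
    quot_germ \<Phi> y (\<lambda>z. g (inv\<^bsub>V\<^esub> a \<otimes>\<^bsub>V\<^esub> z)) (\<lambda>z. h (inv\<^bsub>V\<^esub> a \<otimes>\<^bsub>V\<^esub> z))"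
    (is "translate_germ V a ?F = ?G")
proof
  show "translate_germ V a ?F \<subseteq> ?G"
    unfolding translate_germ_def quot_germ_def by (auto intro: frac_rel_translate)
  show "?G \<subseteq> translate_germ V a ?F"
  proof clarify
    fix g' h' assume "(g', h') \<in> ?G"
    then have "((\<lambda>z. g (inv\<^bsub>V\<^esub> a \<otimes>\<^bsub>V\<^esub> z), \<lambda>z. h (inv\<^bsub>V\<^esub> a \<otimes>\<^bsub>V\<^esub> z)), (g', h')) \<in>
        frac_rel \<Phi> (inv\<^bsub>V\<^esub> (inv\<^bsub>V\<^esub> a) \<otimes>\<^bsub>V\<^esub> (inv\<^bsub>V\<^esub> a \<otimes>\<^bsub>V\<^esub> y))"
      by (simp add: quot_germ_def)
    from frac_rel_translate[OF this]
    have "((g, h), (\<lambda>z. g' (a \<otimes>\<^bsub>V\<^esub> z), \<lambda>z. h' (a \<otimes>\<^bsub>V\<^esub> z))) \<in> frac_rel \<Phi> (inv\<^bsub>V\<^esub> a \<otimes>\<^bsub>V\<^esub> y)"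
      by simp
    then have "(\<lambda>z. g' (a \<otimes>\<^bsub>V\<^esub> z), \<lambda>z. h' (a \<otimes>\<^bsub>V\<^esub> z)) \<in> ?F"
      by (simp add: quot_germ_def)
    then show "(g', h') \<in> translate_germ V a ?F"
      unfolding translate_germ_def by (rule rev_image_eqI) simp
  qed
qed

text \<open>
  Translation by \<open>a\<close> is a ring homomorphism from the stalk at
  \<open>a\<^sup>-\<^sup>1 y\<close> to the stalk at \<open>y\<close>. The base point is given
  at the target, since this is the form in which translations occur in the action.
\<close>

lemma translate_germ_closed:
  "F \<in> carrier (stalk (inv\<^bsub>V\<^esub> a \<otimes>\<^bsub>V\<^esub> y)) \<Longrightarrow> translate_germ V a F \<in> carrier (stalk y)"
  by (auto elim!: stalkE simp: translate_quot_germ intro!: quot_germ_closed fraction_at_translate)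

lemma translate_germ_add:
  assumes F: "F \<in> carrier (stalk (inv\<^bsub>V\<^esub> a \<otimes>\<^bsub>V\<^esub> y))" and G: "G \<in> carrier (stalk (inv\<^bsub>V\<^esub> a \<otimes>\<^bsub>V\<^esub> y))"
  shows "translate_germ V a (F \<oplus>\<^bsub>stalk (inv\<^bsub>V\<^esub> a \<otimes>\<^bsub>V\<^esub> y)\<^esub> G) =
    translate_germ V a F \<oplus>\<^bsub>stalk y\<^esub> translate_germ V a G"
  using F G
  by (auto elim!: stalkE simp: translate_quot_germ stalk_add fraction_at_add fraction_at_translate)

lemma translate_germ_mult:
  assumes F: "F \<in> carrier (stalk (inv\<^bsub>V\<^esub> a \<otimes>\<^bsub>V\<^esub> y))" and G: "G \<in> carrier (stalk (inv\<^bsub>V\<^esub> a \<otimes>\<^bsub>V\<^esub> y))"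
  shows "translate_germ V a (F \<otimes>\<^bsub>stalk (inv\<^bsub>V\<^esub> a \<otimes>\<^bsub>V\<^esub> y)\<^esub> G) =
    translate_germ V a F \<otimes>\<^bsub>stalk y\<^esub> translate_germ V a G"
  using F G
  by (auto elim!: stalkE simp: translate_quot_germ stalk_mult fraction_at_mult fraction_at_translate)

lemma translate_germ_zero [simp]: "translate_germ V a \<zero>\<^bsub>stalk (inv\<^bsub>V\<^esub> a \<otimes>\<^bsub>V\<^esub> y)\<^esub> = \<zero>\<^bsub>stalk y\<^esub>"
  and translate_germ_one [simp]: "translate_germ V a \<one>\<^bsub>stalk (inv\<^bsub>V\<^esub> a \<otimes>\<^bsub>V\<^esub> y)\<^esub> = \<one>\<^bsub>stalk y\<^esub>"
  by (simp_all add: stalk_zero stalk_one translate_quot_germ holo_near_const)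

lemma translate_germ_finsum:
  assumes "finite I" and "\<And>i. i \<in> I \<Longrightarrow> f i \<in> carrier (stalk (inv\<^bsub>V\<^esub> a \<otimes>\<^bsub>V\<^esub> y))"
  shows "translate_germ V a (finsum (stalk (inv\<^bsub>V\<^esub> a \<otimes>\<^bsub>V\<^esub> y)) f I) =
    finsum (stalk y) (\<lambda>i. translate_germ V a (f i)) I"
  using assms
proof (induction I rule: finite_induct)
  case (insert i I)
  then show ?case
    by (simp add: stalk.finsum_insert Pi_def translate_germ_closed translate_germ_add stalk.finsum_closed)
qed simp

lemma translate_holo_germ:
  assumes "holo_near \<Phi> (inv\<^bsub>V\<^esub> a \<otimes>\<^bsub>V\<^esub> y) g"
  shows "translate_germ V a (holo_germ (inv\<^bsub>V\<^esub> a \<otimes>\<^bsub>V\<^esub> y) g) = holo_germ y (\<lambda>z. g (inv\<^bsub>V\<^esub> a \<otimes>\<^bsub>V\<^esub> z))"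
  using assms by (simp add: translate_quot_germ)

lemma translate_germ_holo:
  "F \<in> holo_carrier (inv\<^bsub>V\<^esub> a \<otimes>\<^bsub>V\<^esub> y) \<Longrightarrow> translate_germ V a F \<in> holo_carrier y"
  by (auto elim!: holo_carrierE simp: translate_holo_germ intro!: holo_germ_closed holo_near_translate)

lemma germ_value_translate:
  "F \<in> holo_carrier (inv\<^bsub>V\<^esub> a \<otimes>\<^bsub>V\<^esub> y) \<Longrightarrow>
    germ_value y (translate_germ V a F) = germ_value (inv\<^bsub>V\<^esub> a \<otimes>\<^bsub>V\<^esub> y) F"
  by (auto elim!: holo_carrierE simp: translate_holo_germ holo_near_translate)

end

subsection \<open>Meromorphic functions\<close>

context complex_manifold
begin

abbreviation Mer :: "('a \<Rightarrow> 'a mgerm) ring"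
where
  "Mer \<equiv> meromorphic_functions \<Phi>"

lemma Mer_simps [simp]:
  "mult Mer f f' x = f x \<otimes>\<^bsub>stalk x\<^esub> f' x" "one Mer x = \<one>\<^bsub>stalk x\<^esub>"
  "add Mer f f' x = f x \<oplus>\<^bsub>stalk x\<^esub> f' x" "zero Mer x = \<zero>\<^bsub>stalk x\<^esub>"
  by (simp_all add: meromorphic_functions_def)

lemma holo_nearI: "open S \<Longrightarrow> x \<in> S \<Longrightarrow> holo_on \<Phi> S f \<Longrightarrow> holo_near \<Phi> x f"
  unfolding holo_near_def by blast

text \<open>
  Functions holomorphic on an open set are holomorphic near each of its points, so the local
  quotients are fractions in the sense of the stalks.
\<close>

lemma carrier_Mer:
  "carrier Mer = {f. \<forall>x. \<exists>S g h. open S \<and> x \<in> S \<and> holo_on \<Phi> S g \<and> holo_on \<Phi> S h \<and>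
    (\<forall>y\<in>S. fraction_at y g h \<and> f y = quot_germ \<Phi> y g h)}"
proof -
  have "(\<forall>y\<in>S. \<not> (\<forall>\<^sub>F z in nhds y. h z = 0) \<and> f y = quot_germ \<Phi> y g h) \<longleftrightarrow>
      (\<forall>y\<in>S. fraction_at y g h \<and> f y = quot_germ \<Phi> y g h)"
    if "open S" "holo_on \<Phi> S g" "holo_on \<Phi> S h" for S g h f
    using that holo_nearI unfolding fraction_at_def by blast
  then show ?thesis
    unfolding meromorphic_functions_def by (simp cong: conj_cong)
qed

lemma MerE:
  assumes "f \<in> carrier Mer"
  obtains S g h where "open S" "x \<in> S" "holo_on \<Phi> S g" "holo_on \<Phi> S h"
    "\<forall>y\<in>S. fraction_at y g h \<and> f y = quot_germ \<Phi> y g h"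
proof -
  have "\<exists>S g h. open S \<and> x \<in> S \<and> holo_on \<Phi> S g \<and> holo_on \<Phi> S h \<and>
    (\<forall>y\<in>S. fraction_at y g h \<and> f y = quot_germ \<Phi> y g h)"
    using assms unfolding carrier_Mer by simp
  then show ?thesis using that by blast
qed

lemma MerI:
  assumes "\<And>x. \<exists>S g h. open S \<and> x \<in> S \<and> holo_on \<Phi> S g \<and> holo_on \<Phi> S h \<and>
    (\<forall>y\<in>S. fraction_at y g h \<and> f y = quot_germ \<Phi> y g h)"
  shows "f \<in> carrier Mer"
  unfolding carrier_Mer using assms by simp

lemma Mer_in_stalk: "f \<in> carrier Mer \<Longrightarrow> f x \<in> carrier (stalk x)"
  by (rule MerE[of f x]) (auto simp: quot_germ_closed)

lemma Mer_holo: "holo_on \<Phi> UNIV f \<Longrightarrow> (\<lambda>x. holo_germ x f) \<in> carrier Mer"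
  by (rule MerI, rule exI[of _ UNIV], rule exI[of _ f], rule exI[of _ "\<lambda>y. 1"])
    (simp add: holo_on_const holo_near_global)

lemma Mer_zero: "\<zero>\<^bsub>Mer\<^esub> \<in> carrier Mer"
  using Mer_holo[OF holo_on_const[of UNIV 0]] by (simp add: meromorphic_functions_def stalk_zero)

lemma Mer_one: "\<one>\<^bsub>Mer\<^esub> \<in> carrier Mer"
  using Mer_holo[OF holo_on_const[of UNIV 1]] by (simp add: meromorphic_functions_def stalk_one)

lemma Mer_add:
  assumes f: "f \<in> carrier Mer" and f': "f' \<in> carrier Mer"
  shows "f \<oplus>\<^bsub>Mer\<^esub> f' \<in> carrier Mer"
proof (rule MerI)
  fix x
  obtain S g h where S: "open S" "x \<in> S" "holo_on \<Phi> S g" "holo_on \<Phi> S h"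
    "\<forall>y\<in>S. fraction_at y g h \<and> f y = quot_germ \<Phi> y g h"
    using f by (rule MerE[where x = x])
  obtain S' g' h' where S': "open S'" "x \<in> S'" "holo_on \<Phi> S' g'" "holo_on \<Phi> S' h'"
    "\<forall>y\<in>S'. fraction_at y g' h' \<and> f' y = quot_germ \<Phi> y g' h'"
    using f' by (rule MerE[where x = x])
  have sub: "holo_on \<Phi> (S \<inter> S') g" "holo_on \<Phi> (S \<inter> S') h" "holo_on \<Phi> (S \<inter> S') g'" "holo_on \<Phi> (S \<inter> S') h'"
    using S(3,4) S'(3,4) by (auto intro: holo_on_subset)
  show "\<exists>S g h. open S \<and> x \<in> S \<and> holo_on \<Phi> S g \<and> holo_on \<Phi> S h \<and>
    (\<forall>y\<in>S. fraction_at y g h \<and> (f \<oplus>\<^bsub>Mer\<^esub> f') y = quot_germ \<Phi> y g h)"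
  proof (intro exI conjI ballI)
    show "open (S \<inter> S')" "x \<in> S \<inter> S'" using S(1,2) S'(1,2) by auto
    show "holo_on \<Phi> (S \<inter> S') (\<lambda>y. g y * h' y + g' y * h y)" "holo_on \<Phi> (S \<inter> S') (\<lambda>y. h y * h' y)"
      by (intro holo_on_add holo_on_mult sub)+
    fix y assume "y \<in> S \<inter> S'"
    then show "fraction_at y (\<lambda>y. g y * h' y + g' y * h y) (\<lambda>y. h y * h' y)"
      "(f \<oplus>\<^bsub>Mer\<^esub> f') y = quot_germ \<Phi> y (\<lambda>y. g y * h' y + g' y * h y) (\<lambda>y. h y * h' y)"
      using S(5) S'(5) by (simp_all add: fraction_at_add stalk_add)
  qed
qed

lemma Mer_mult:
  assumes f: "f \<in> carrier Mer" and f': "f' \<in> carrier Mer"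
  shows "f \<otimes>\<^bsub>Mer\<^esub> f' \<in> carrier Mer"
proof (rule MerI)
  fix x
  obtain S g h where S: "open S" "x \<in> S" "holo_on \<Phi> S g" "holo_on \<Phi> S h"
    "\<forall>y\<in>S. fraction_at y g h \<and> f y = quot_germ \<Phi> y g h"
    using f by (rule MerE[where x = x])
  obtain S' g' h' where S': "open S'" "x \<in> S'" "holo_on \<Phi> S' g'" "holo_on \<Phi> S' h'"
    "\<forall>y\<in>S'. fraction_at y g' h' \<and> f' y = quot_germ \<Phi> y g' h'"
    using f' by (rule MerE[where x = x])
  have sub: "holo_on \<Phi> (S \<inter> S') g" "holo_on \<Phi> (S \<inter> S') h" "holo_on \<Phi> (S \<inter> S') g'" "holo_on \<Phi> (S \<inter> S') h'"
    using S(3,4) S'(3,4) by (auto intro: holo_on_subset)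
  show "\<exists>S g h. open S \<and> x \<in> S \<and> holo_on \<Phi> S g \<and> holo_on \<Phi> S h \<and>
    (\<forall>y\<in>S. fraction_at y g h \<and> (f \<otimes>\<^bsub>Mer\<^esub> f') y = quot_germ \<Phi> y g h)"
  proof (intro exI conjI ballI)
    show "open (S \<inter> S')" "x \<in> S \<inter> S'" using S(1,2) S'(1,2) by auto
    show "holo_on \<Phi> (S \<inter> S') (\<lambda>y. g y * g' y)" "holo_on \<Phi> (S \<inter> S') (\<lambda>y. h y * h' y)"
      by (intro holo_on_mult sub)+
    fix y assume "y \<in> S \<inter> S'"
    then show "fraction_at y (\<lambda>y. g y * g' y) (\<lambda>y. h y * h' y)"
      "(f \<otimes>\<^bsub>Mer\<^esub> f') y = quot_germ \<Phi> y (\<lambda>y. g y * g' y) (\<lambda>y. h y * h' y)"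
      using S(5) S'(5) by (simp_all add: fraction_at_mult stalk_mult)
  qed
qed

text \<open>
  The inverse is the product with the constant function \<open>-1\<close>, which is a section
  because products are.
\<close>

lemma abelian_group_Mer: "abelian_group Mer"
proof (rule abelian_groupI)
  fix f assume f: "f \<in> carrier Mer"
  let ?c = "\<lambda>x. holo_germ x (\<lambda>y. - 1)"
  have c: "?c \<in> carrier Mer" by (rule Mer_holo[OF holo_on_const])
  have "?c \<otimes>\<^bsub>Mer\<^esub> f \<oplus>\<^bsub>Mer\<^esub> f = \<zero>\<^bsub>Mer\<^esub>"
  proof
    fix x
    have "?c x = \<ominus>\<^bsub>stalk x\<^esub> \<one>\<^bsub>stalk x\<^esub>"
      by (simp add: stalk_one holo_germ_uminus holo_near_const)
    then show "(?c \<otimes>\<^bsub>Mer\<^esub> f \<oplus>\<^bsub>Mer\<^esub> f) x = \<zero>\<^bsub>Mer\<^esub> x"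
      using Mer_in_stalk[OF f] by (simp add: stalk.l_minus stalk.l_neg)
  qed
  then show "\<exists>g\<in>carrier Mer. g \<oplus>\<^bsub>Mer\<^esub> f = \<zero>\<^bsub>Mer\<^esub>"
    using Mer_mult[OF c f] by blast
qed (auto intro!: Mer_add Mer_zero simp: fun_eq_iff stalk.a_ac Mer_in_stalk)

end

sublocale complex_manifold \<subseteq> Mer: abelian_group "meromorphic_functions \<Phi>"
  by (rule abelian_group_Mer)

context complex_lie
begin

lemma finsum_Mer:
  assumes "finite I" and "\<And>i. i \<in> I \<Longrightarrow> f i \<in> carrier Mer"
  shows "finsum Mer f I x = finsum (stalk x) (\<lambda>i. f i x) I"
  using assms
proof (induction I rule: finite_induct)
  case (insert i I)
  then show ?case
    by (simp add: Mer.finsum_insert stalk.finsum_insert Pi_def Mer_in_stalk)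
qed simp

lemma translate_section_closed:
  assumes f: "f \<in> carrier Mer"
  shows "translate_section V a f \<in> carrier Mer"
proof (rule MerI)
  fix x
  let ?b = "inv\<^bsub>V\<^esub> a"
  obtain S g h where S: "open S" "?b \<otimes>\<^bsub>V\<^esub> x \<in> S" "holo_on \<Phi> S g" "holo_on \<Phi> S h"
    "\<forall>y\<in>S. fraction_at y g h \<and> f y = quot_germ \<Phi> y g h"
    using f by (rule MerE[where x = "?b \<otimes>\<^bsub>V\<^esub> x"])
  show "\<exists>S g h. open S \<and> x \<in> S \<and> holo_on \<Phi> S g \<and> holo_on \<Phi> S h \<and>
    (\<forall>y\<in>S. fraction_at y g h \<and> translate_section V a f y = quot_germ \<Phi> y g h)"
  proof (intro exI conjI ballI)
    let ?T = "(\<lambda>x. ?b \<otimes>\<^bsub>V\<^esub> x) -` S"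
    show "open ?T"
      using holomorphic_left_translation[of ?b] S(1)
      unfolding holomorphic_map_def by (simp add: open_vimage)
    show "x \<in> ?T" using S(2) by simp
    show "holo_on \<Phi> ?T (\<lambda>z. g (?b \<otimes>\<^bsub>V\<^esub> z))" "holo_on \<Phi> ?T (\<lambda>z. h (?b \<otimes>\<^bsub>V\<^esub> z))"
      using S(3,4) by (auto intro: holo_on_pullback[OF holomorphic_left_translation])
    fix y assume "y \<in> ?T"
    then show "fraction_at y (\<lambda>z. g (?b \<otimes>\<^bsub>V\<^esub> z)) (\<lambda>z. h (?b \<otimes>\<^bsub>V\<^esub> z))"
      "translate_section V a f y = quot_germ \<Phi> y (\<lambda>z. g (?b \<otimes>\<^bsub>V\<^esub> z)) (\<lambda>z. h (?b \<otimes>\<^bsub>V\<^esub> z))"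
      using S(5) by (simp_all add: fraction_at_translate translate_section_def translate_quot_germ)
  qed
qed

end

section \<open>The skew-group ring acts on families of germs\<close>

lemma (in abelian_monoid) finsum_swap:
  assumes "finite I" "finite J" "\<And>i j. i \<in> I \<Longrightarrow> j \<in> J \<Longrightarrow> f i j \<in> carrier G"
  shows "finsum G (\<lambda>i. finsum G (f i) J) I = finsum G (\<lambda>j. finsum G (\<lambda>i. f i j) I) J"
  using assms(1,3)
proof (induction I rule: finite_induct)
  case (insert i I)
  have "finsum G (\<lambda>i. finsum G (f i) J) (insert i I) =
      finsum G (f i) J \<oplus> finsum G (\<lambda>j. finsum G (\<lambda>i. f i j) I) J"
    using insert by (simp add: finsum_insert Pi_def)
  also have "\<dots> = finsum G (\<lambda>j. f i j \<oplus> finsum G (\<lambda>i. f i j) I) J"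
    using insert by (intro finsum_addf[symmetric]) (auto intro!: finsum_closed)
  also have "\<dots> = finsum G (\<lambda>j. finsum G (\<lambda>i. f i j) (insert i I)) J"
    using insert by (intro finsum_cong') (auto intro!: finsum_closed simp: finsum_insert Pi_def)
  finally show ?case .
qed (simp add: finsum_zero)

context complex_lie
begin

abbreviation Skew :: "('a \<Rightarrow> 'a \<Rightarrow> 'a mgerm) ring"
where
  "Skew \<equiv> skew_ring V \<Phi>"

abbreviation supp :: "('a \<Rightarrow> 'a \<Rightarrow> 'a mgerm) \<Rightarrow> 'a set"
where
  "supp \<equiv> skew_support \<Phi>"

abbreviation act :: "('a \<Rightarrow> 'a \<Rightarrow> 'a mgerm) \<Rightarrow> ('a \<Rightarrow> 'a mgerm) \<Rightarrow> ('a \<Rightarrow> 'a mgerm)"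
where
  "act \<equiv> skew_act V \<Phi>"

text \<open>
  All families of meromorphic germs, without a condition on their support: each component of the
  image under an element of the skew-group ring is a finite sum anyway.
\<close>

definition germ_families :: "('a \<Rightarrow> 'a mgerm) set"
where
  "germ_families = {u. \<forall>x. u x \<in> carrier (stalk x)}"

abbreviation zero_family :: "'a \<Rightarrow> 'a mgerm"
where
  "zero_family \<equiv> \<lambda>x. \<zero>\<^bsub>stalk x\<^esub>"

abbreviation add_family :: "('a \<Rightarrow> 'a mgerm) \<Rightarrow> ('a \<Rightarrow> 'a mgerm) \<Rightarrow> ('a \<Rightarrow> 'a mgerm)"
where
  "add_family u w \<equiv> \<lambda>x. u x \<oplus>\<^bsub>stalk x\<^esub> w x"

text \<open>
  The delta functions of the direct sum of stalks.
\<close>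

definition point_family :: "'a \<Rightarrow> 'a mgerm \<Rightarrow> 'a \<Rightarrow> 'a mgerm"
where
  "point_family x F = (zero_family)(x := F)"

definition skew_term :: "('a \<Rightarrow> 'a \<Rightarrow> 'a mgerm) \<Rightarrow> ('a \<Rightarrow> 'a mgerm) \<Rightarrow> 'a \<Rightarrow> 'a \<Rightarrow> 'a mgerm"
where
  "skew_term A u y \<xi> = A \<xi> y \<otimes>\<^bsub>stalk y\<^esub> translate_germ V \<xi> (u (inv\<^bsub>V\<^esub> \<xi> \<otimes>\<^bsub>V\<^esub> y))"

lemma SkewD:
  assumes "A \<in> carrier Skew"
  shows "A \<xi> \<in> carrier Mer" "finite (supp A)" "A \<xi> y \<in> carrier (stalk y)"
  using assms Mer_in_stalk by (auto simp: skew_ring_def)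

lemma SkewI: "(\<And>\<xi>. A \<xi> \<in> carrier Mer) \<Longrightarrow> finite S \<Longrightarrow> supp A \<subseteq> S \<Longrightarrow> A \<in> carrier Skew"
  by (auto simp: skew_ring_def intro: finite_subset)

lemma not_supp: "\<xi> \<notin> supp A \<Longrightarrow> A \<xi> y = \<zero>\<^bsub>stalk y\<^esub>"
  by (simp add: skew_support_def)

lemma familyD: "u \<in> germ_families \<Longrightarrow> u x \<in> carrier (stalk x)"
  by (simp add: germ_families_def)

lemma skew_term_closed:
  "A \<in> carrier Skew \<Longrightarrow> u \<in> germ_families \<Longrightarrow> skew_term A u y \<xi> \<in> carrier (stalk y)"
  by (simp add: skew_term_def SkewD familyD translate_germ_closed)

text \<open>
  The support can shrink when elements are added or multiplied. Summing over any finite set that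
  contains it makes sums for different elements comparable.
\<close>

lemma act_eq:
  assumes A: "A \<in> carrier Skew" and u: "u \<in> germ_families" and S: "finite S" "supp A \<subseteq> S"
  shows "act A u y = finsum (stalk y) (skew_term A u y) S"
  unfolding skew_act_def
  by (rule stalk.add.finprod_mono_neutral_cong_left[OF S])
    (use A u in \<open>auto simp: skew_term_def not_supp SkewD familyD translate_germ_closed\<close>)

lemma act_closed: "A \<in> carrier Skew \<Longrightarrow> u \<in> germ_families \<Longrightarrow> act A u \<in> germ_families"
  by (subst germ_families_def)
    (auto simp: act_eq[OF _ _ SkewD(2) order_refl] skew_term_closed intro!: stalk.finsum_closed)

lemma add_family_closed:
  "u \<in> germ_families \<Longrightarrow> w \<in> germ_families \<Longrightarrow> add_family u w \<in> germ_families"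
  by (simp add: germ_families_def)

lemma act_add_family:
  assumes A: "A \<in> carrier Skew" and u: "u \<in> germ_families" and w: "w \<in> germ_families"
  shows "act A (add_family u w) = add_family (act A u) (act A w)"
proof
  fix y
  have "skew_term A (add_family u w) y \<xi> = skew_term A u y \<xi> \<oplus>\<^bsub>stalk y\<^esub> skew_term A w y \<xi>" for \<xi>
    by (simp add: skew_term_def translate_germ_add stalk.r_distr A u w SkewD familyD translate_germ_closed)
  then have "finsum (stalk y) (skew_term A (add_family u w) y) (supp A) =
      finsum (stalk y) (\<lambda>\<xi>. skew_term A u y \<xi> \<oplus>\<^bsub>stalk y\<^esub> skew_term A w y \<xi>) (supp A)"
    by presburger
  also have "\<dots> = finsum (stalk y) (skew_term A u y) (supp A) \<oplus>\<^bsub>stalk y\<^esub> finsum (stalk y) (skew_term A w y) (supp A)"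
    by (intro stalk.finsum_addf) (auto intro: skew_term_closed A u w)
  finally show "act A (add_family u w) y = act A u y \<oplus>\<^bsub>stalk y\<^esub> act A w y"
    by (simp add: act_eq[OF A _ SkewD(2)[OF A] order_refl] add_family_closed u w)
qed

lemma Skew_add_apply: "(A \<oplus>\<^bsub>Skew\<^esub> B) \<xi> = A \<xi> \<oplus>\<^bsub>Mer\<^esub> B \<xi>"
  by (simp add: skew_ring_def)

lemma supp_add: "supp (A \<oplus>\<^bsub>Skew\<^esub> B) \<subseteq> supp A \<union> supp B"
proof
  fix \<xi> assume "\<xi> \<in> supp (A \<oplus>\<^bsub>Skew\<^esub> B)"
  then show "\<xi> \<in> supp A \<union> supp B"
    using Mer.l_zero[OF Mer.zero_closed] by (auto simp: skew_support_def Skew_add_apply)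
qed

lemma Skew_add_closed:
  assumes "A \<in> carrier Skew" "B \<in> carrier Skew"
  shows "A \<oplus>\<^bsub>Skew\<^esub> B \<in> carrier Skew"
proof (rule SkewI)
  show "finite (supp A \<union> supp B)" using assms SkewD by simp
qed (use assms SkewD supp_add in \<open>auto simp: Skew_add_apply\<close>)

lemma act_add:
  assumes A: "A \<in> carrier Skew" and B: "B \<in> carrier Skew" and u: "u \<in> germ_families"
  shows "act (A \<oplus>\<^bsub>Skew\<^esub> B) u = add_family (act A u) (act B u)"
proof
  fix y
  let ?S = "supp A \<union> supp B"
  have S: "finite ?S" using A B SkewD by simp
  have "skew_term (A \<oplus>\<^bsub>Skew\<^esub> B) u y \<xi> = skew_term A u y \<xi> \<oplus>\<^bsub>stalk y\<^esub> skew_term B u y \<xi>" for \<xi>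
    by (simp add: skew_term_def Skew_add_apply stalk.l_distr A B u SkewD familyD translate_germ_closed)
  then have "finsum (stalk y) (skew_term (A \<oplus>\<^bsub>Skew\<^esub> B) u y) ?S =
      finsum (stalk y) (\<lambda>\<xi>. skew_term A u y \<xi> \<oplus>\<^bsub>stalk y\<^esub> skew_term B u y \<xi>) ?S"
    by presburger
  also have "\<dots> = finsum (stalk y) (skew_term A u y) ?S \<oplus>\<^bsub>stalk y\<^esub> finsum (stalk y) (skew_term B u y) ?S"
    by (intro stalk.finsum_addf) (auto intro: skew_term_closed A B u)
  finally show "act (A \<oplus>\<^bsub>Skew\<^esub> B) u y = act A u y \<oplus>\<^bsub>stalk y\<^esub> act B u y"
    by (simp add: act_eq[OF _ u S] A B Skew_add_closed supp_add)
qed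

lemma point_family_closed: "F \<in> carrier (stalk x) \<Longrightarrow> point_family x F \<in> germ_families"
  by (simp add: germ_families_def point_family_def)

text \<open>
  Only the term of \<open>\<xi>\<close> sees a family that is concentrated at
  \<open>\<xi>\<^sup>-\<^sup>1 y\<close>, because \<open>\<xi>\<close> is determined by that
  point and \<open>y\<close>.
\<close>

lemma act_point_family:
  assumes A: "A \<in> carrier Skew" and F: "F \<in> carrier (stalk (inv\<^bsub>V\<^esub> \<xi> \<otimes>\<^bsub>V\<^esub> y))"
  shows "act A (point_family (inv\<^bsub>V\<^esub> \<xi> \<otimes>\<^bsub>V\<^esub> y) F) y = A \<xi> y \<otimes>\<^bsub>stalk y\<^esub> translate_germ V \<xi> F"
proof -
  let ?u = "point_family (inv\<^bsub>V\<^esub> \<xi> \<otimes>\<^bsub>V\<^esub> y) F"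
  have u: "?u \<in> germ_families" by (rule point_family_closed[OF F])
  have S: "finite (insert \<xi> (supp A))" using A SkewD by simp
  have term_ne: "skew_term A ?u y \<eta> = \<zero>\<^bsub>stalk y\<^esub>" if "\<eta> \<noteq> \<xi>" for \<eta>
  proof -
    have "inv\<^bsub>V\<^esub> \<eta> \<otimes>\<^bsub>V\<^esub> y \<noteq> inv\<^bsub>V\<^esub> \<xi> \<otimes>\<^bsub>V\<^esub> y"
      using that V.inv_inj by (auto simp: inj_on_def)
    then show ?thesis using A by (simp add: skew_term_def point_family_def SkewD)
  qed
  have "act A ?u y = finsum (stalk y) (skew_term A ?u y) (insert \<xi> (supp A))"
    by (rule act_eq[OF A u S]) auto
  also have "\<dots> = finsum (stalk y) (skew_term A ?u y) {\<xi>}"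
    by (rule stalk.add.finprod_mono_neutral_cong_right[OF S])
      (use term_ne A u in \<open>auto intro: skew_term_closed\<close>)
  also have "\<dots> = A \<xi> y \<otimes>\<^bsub>stalk y\<^esub> translate_germ V \<xi> F"
    using skew_term_closed[OF A u, of y \<xi>]
    by (simp add: stalk.finsum_insert) (simp add: skew_term_def point_family_def)
  finally show ?thesis .
qed

text \<open>
  The unit germ at \<open>\<xi>\<^sup>-\<^sup>1 y\<close> recovers the germ at \<open>y\<close>
  of the coefficient of \<open>\<xi>\<close>.
\<close>

lemma act_faithful:
  assumes A: "A \<in> carrier Skew" and B: "B \<in> carrier Skew"
    and eq: "\<And>u. u \<in> germ_families \<Longrightarrow> act A u = act B u"
  shows "A = B"
proof (intro ext)
  fix \<xi> y
  let ?x = "inv\<^bsub>V\<^esub> \<xi> \<otimes>\<^bsub>V\<^esub> y"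
  have "act A (point_family ?x \<one>\<^bsub>stalk ?x\<^esub>) y = act B (point_family ?x \<one>\<^bsub>stalk ?x\<^esub>) y"
    by (simp add: eq point_family_closed)
  then show "A \<xi> y = B \<xi> y"
    using A B by (simp add: act_point_family SkewD)
qed

lemma Skew_mult_apply:
  assumes A: "A \<in> carrier Skew" and B: "B \<in> carrier Skew"
  shows "(A \<otimes>\<^bsub>Skew\<^esub> B) \<zeta> y = finsum (stalk y)
    (\<lambda>\<xi>. A \<xi> y \<otimes>\<^bsub>stalk y\<^esub> translate_germ V \<xi> (B (inv\<^bsub>V\<^esub> \<xi> \<otimes>\<^bsub>V\<^esub> \<zeta>) (inv\<^bsub>V\<^esub> \<xi> \<otimes>\<^bsub>V\<^esub> y))) (supp A)"
  using A B
  by (simp add: skew_ring_def finsum_Mer Mer_mult translate_section_closed)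
    (simp add: translate_section_def)

lemma supp_mult:
  assumes A: "A \<in> carrier Skew" and B: "B \<in> carrier Skew"
  shows "supp (A \<otimes>\<^bsub>Skew\<^esub> B) \<subseteq> (\<lambda>(\<xi>, \<eta>). \<xi> \<otimes>\<^bsub>V\<^esub> \<eta>) ` (supp A \<times> supp B)"
proof
  fix \<zeta> assume \<zeta>: "\<zeta> \<in> supp (A \<otimes>\<^bsub>Skew\<^esub> B)"
  show "\<zeta> \<in> (\<lambda>(\<xi>, \<eta>). \<xi> \<otimes>\<^bsub>V\<^esub> \<eta>) ` (supp A \<times> supp B)"
  proof (rule ccontr)
    assume neg: "\<not> ?thesis"
    have "inv\<^bsub>V\<^esub> \<xi> \<otimes>\<^bsub>V\<^esub> \<zeta> \<notin> supp B" if "\<xi> \<in> supp A" for \<xi>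
    proof
      assume "inv\<^bsub>V\<^esub> \<xi> \<otimes>\<^bsub>V\<^esub> \<zeta> \<in> supp B"
      then have "\<zeta> \<in> (\<lambda>(\<xi>, \<eta>). \<xi> \<otimes>\<^bsub>V\<^esub> \<eta>) ` (supp A \<times> supp B)"
        using that by (intro image_eqI[of _ _ "(\<xi>, inv\<^bsub>V\<^esub> \<xi> \<otimes>\<^bsub>V\<^esub> \<zeta>)"]) auto
      with neg show False by blast
    qed
    then have "(A \<otimes>\<^bsub>Skew\<^esub> B) \<zeta> y = \<zero>\<^bsub>stalk y\<^esub>" for y
      unfolding Skew_mult_apply[OF A B]
      by (intro stalk.add.finprod_one_eqI) (simp add: not_supp SkewD A)
    then have "(A \<otimes>\<^bsub>Skew\<^esub> B) \<zeta> = \<zero>\<^bsub>Mer\<^esub>" by (simp add: fun_eq_iff)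
    with \<zeta> show False by (simp add: skew_support_def)
  qed
qed

lemma Skew_mult_closed:
  assumes A: "A \<in> carrier Skew" and B: "B \<in> carrier Skew"
  shows "A \<otimes>\<^bsub>Skew\<^esub> B \<in> carrier Skew"
proof (rule SkewI[OF _ _ supp_mult[OF A B]])
  show "finite ((\<lambda>(\<xi>, \<eta>). \<xi> \<otimes>\<^bsub>V\<^esub> \<eta>) ` (supp A \<times> supp B))"
    using SkewD(2)[OF A] SkewD(2)[OF B] by simp
  show "(A \<otimes>\<^bsub>Skew\<^esub> B) \<zeta> \<in> carrier Mer" for \<zeta>
    using SkewD(1)[OF A] SkewD(1)[OF B]
    by (simp add: skew_ring_def) (auto intro!: Mer.finsum_closed Mer_mult translate_section_closed)
qed

text \<open>
  Both sides are the sum over \<open>\<xi>\<close> and \<open>\<eta>\<close> of the terms with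
  \<open>\<zeta> = \<xi> \<eta>\<close>: on the left they are collected by
  \<open>\<zeta>\<close>, on the right by \<open>\<xi>\<close>. For fixed \<open>\<xi>\<close>
  the terms whose \<open>\<xi>\<^sup>-\<^sup>1 \<zeta>\<close> lies outside the support of
  \<open>B\<close> vanish.
\<close>

lemma act_mult:
  assumes A: "A \<in> carrier Skew" and B: "B \<in> carrier Skew" and u: "u \<in> germ_families"
  shows "act (A \<otimes>\<^bsub>Skew\<^esub> B) u = act A (act B u)"
proof
  fix y
  define S where "S = supp A"
  define T where "T = supp B"
  define Z where "Z = (\<lambda>(\<xi>, \<eta>). \<xi> \<otimes>\<^bsub>V\<^esub> \<eta>) ` (S \<times> T)"
  have fin: "finite S" "finite T" "finite Z"
    using SkewD(2)[OF A] SkewD(2)[OF B] by (simp_all add: S_def T_def Z_def)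
  define b where "b \<xi> \<zeta> = translate_germ V \<xi> (B (inv\<^bsub>V\<^esub> \<xi> \<otimes>\<^bsub>V\<^esub> \<zeta>) (inv\<^bsub>V\<^esub> \<xi> \<otimes>\<^bsub>V\<^esub> y))" for \<xi> \<zeta>
  define t where "t \<zeta> = translate_germ V \<zeta> (u (inv\<^bsub>V\<^esub> \<zeta> \<otimes>\<^bsub>V\<^esub> y))" for \<zeta>
  define f where "f \<xi> \<zeta> = A \<xi> y \<otimes>\<^bsub>stalk y\<^esub> b \<xi> \<zeta> \<otimes>\<^bsub>stalk y\<^esub> t \<zeta>" for \<xi> \<zeta>
  have a_in [simp]: "A \<xi> y \<in> carrier (stalk y)" for \<xi> by (rule SkewD(3)[OF A])
  have b_in [simp]: "b \<xi> \<zeta> \<in> carrier (stalk y)" for \<xi> \<zeta>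
    unfolding b_def by (rule translate_germ_closed[OF SkewD(3)[OF B]])
  have t_in [simp]: "t \<zeta> \<in> carrier (stalk y)" for \<zeta>
    unfolding t_def by (rule translate_germ_closed[OF familyD[OF u]])
  have f_in [simp]: "f \<xi> \<zeta> \<in> carrier (stalk y)" for \<xi> \<zeta> by (simp add: f_def)
  \<comment> \<open>Collect the terms with the same \<open>\<xi>\<close>, substituting \<open>\<zeta> = \<xi> \<eta>\<close>.\<close>
  have row: "finsum (stalk y) (f \<xi>) Z = skew_term A (act B u) y \<xi>" if \<xi>: "\<xi> \<in> S" for \<xi>
  proof -
    let ?x = "inv\<^bsub>V\<^esub> \<xi> \<otimes>\<^bsub>V\<^esub> y"
    have "finsum (stalk y) (f \<xi>) Z = finsum (stalk y) (f \<xi>) ((\<lambda>\<eta>. \<xi> \<otimes>\<^bsub>V\<^esub> \<eta>) ` T)"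
    proof (rule stalk.add.finprod_mono_neutral_cong_right[OF fin(3)])
      show "(\<lambda>\<eta>. \<xi> \<otimes>\<^bsub>V\<^esub> \<eta>) ` T \<subseteq> Z" using \<xi> by (auto simp: Z_def)
      fix \<zeta> assume \<zeta>: "\<zeta> \<in> Z - (\<lambda>\<eta>. \<xi> \<otimes>\<^bsub>V\<^esub> \<eta>) ` T"
      have "inv\<^bsub>V\<^esub> \<xi> \<otimes>\<^bsub>V\<^esub> \<zeta> \<notin> T"
      proof
        assume "inv\<^bsub>V\<^esub> \<xi> \<otimes>\<^bsub>V\<^esub> \<zeta> \<in> T"
        then have "\<xi> \<otimes>\<^bsub>V\<^esub> (inv\<^bsub>V\<^esub> \<xi> \<otimes>\<^bsub>V\<^esub> \<zeta>) \<in> (\<lambda>\<eta>. \<xi> \<otimes>\<^bsub>V\<^esub> \<eta>) ` T" by blast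
        with \<zeta> show False by simp
      qed
      then have "b \<xi> \<zeta> = \<zero>\<^bsub>stalk y\<^esub>" by (simp add: b_def T_def not_supp)
      then show "f \<xi> \<zeta> = \<zero>\<^bsub>stalk y\<^esub>" by (simp add: f_def)
    qed auto
    also have "\<dots> = finsum (stalk y) (\<lambda>\<eta>. f \<xi> (\<xi> \<otimes>\<^bsub>V\<^esub> \<eta>)) T"
      by (rule stalk.finsum_reindex) (auto intro!: inj_onI)
    also have "\<dots> = finsum (stalk y) (\<lambda>\<eta>. A \<xi> y \<otimes>\<^bsub>stalk y\<^esub> translate_germ V \<xi> (skew_term B u ?x \<eta>)) T"
    proof (rule stalk.finsum_cong')
      fix \<eta>
      show "f \<xi> (\<xi> \<otimes>\<^bsub>V\<^esub> \<eta>) = A \<xi> y \<otimes>\<^bsub>stalk y\<^esub> translate_germ V \<xi> (skew_term B u ?x \<eta>)"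
        using stalk.m_assoc[of "A \<xi> y" y "b \<xi> (\<xi> \<otimes>\<^bsub>V\<^esub> \<eta>)" "t (\<xi> \<otimes>\<^bsub>V\<^esub> \<eta>)"]
        by (simp add: f_def b_def t_def skew_term_def translate_germ_mult SkewD(3)[OF B]
            translate_germ_closed familyD[OF u] translate_germ_translate_germ inv_mult_apply)
    qed (auto intro!: stalk.m_closed translate_germ_closed skew_term_closed B u)
    also have "\<dots> = A \<xi> y \<otimes>\<^bsub>stalk y\<^esub> finsum (stalk y) (\<lambda>\<eta>. translate_germ V \<xi> (skew_term B u ?x \<eta>)) T"
      by (rule stalk.finsum_rdistr[symmetric])
        (auto intro!: fin translate_germ_closed skew_term_closed B u)
    also have "\<dots> = skew_term A (act B u) y \<xi>"
      by (simp add: skew_term_def[of A] act_eq[OF B u fin(2)] T_def[symmetric]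
          translate_germ_finsum fin skew_term_closed B u)
    finally show ?thesis .
  qed
  have "act (A \<otimes>\<^bsub>Skew\<^esub> B) u y = finsum (stalk y) (skew_term (A \<otimes>\<^bsub>Skew\<^esub> B) u y) Z"
    using supp_mult[OF A B]
    by (intro act_eq[OF Skew_mult_closed[OF A B] u fin(3)]) (simp add: Z_def S_def T_def)
  also have "\<dots> = finsum (stalk y) (\<lambda>\<zeta>. finsum (stalk y) (\<lambda>\<xi>. f \<xi> \<zeta>) S) Z"
  proof (rule stalk.finsum_cong')
    fix \<zeta>
    have "skew_term (A \<otimes>\<^bsub>Skew\<^esub> B) u y \<zeta> = finsum (stalk y) (\<lambda>\<xi>. A \<xi> y \<otimes>\<^bsub>stalk y\<^esub> b \<xi> \<zeta>) S \<otimes>\<^bsub>stalk y\<^esub> t \<zeta>"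
      by (simp add: skew_term_def Skew_mult_apply[OF A B] b_def t_def S_def)
    also have "\<dots> = finsum (stalk y) (\<lambda>\<xi>. f \<xi> \<zeta>) S"
      unfolding f_def by (rule stalk.finsum_ldistr) (auto simp: fin)
    finally show "skew_term (A \<otimes>\<^bsub>Skew\<^esub> B) u y \<zeta> = finsum (stalk y) (\<lambda>\<xi>. f \<xi> \<zeta>) S" .
  qed (auto intro!: stalk.finsum_closed)
  also have "\<dots> = finsum (stalk y) (\<lambda>\<xi>. finsum (stalk y) (f \<xi>) Z) S"
    by (rule stalk.finsum_swap[OF fin(3,1)]) simp
  also have "\<dots> = finsum (stalk y) (skew_term A (act B u) y) S"
    by (rule stalk.finsum_cong') (auto simp: row intro!: skew_term_closed act_closed A B u)
  also have "\<dots> = act A (act B u) y"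
    by (rule act_eq[symmetric, OF A act_closed[OF B u] fin(1)]) (simp add: S_def)
  finally show "act (A \<otimes>\<^bsub>Skew\<^esub> B) u y = act A (act B u) y" .
qed

subsection \<open>Multiplication operators\<close>

text \<open>
  The elements \<open>f \<phi>\<^sub>1\<close> of the skew-group ring, which act by
  multiplication.
\<close>

definition mult_op :: "('a \<Rightarrow> 'a mgerm) \<Rightarrow> 'a \<Rightarrow> 'a \<Rightarrow> 'a mgerm"
where
  "mult_op f = (\<lambda>\<xi>. if \<xi> = \<one>\<^bsub>V\<^esub> then f else \<zero>\<^bsub>Mer\<^esub>)"

lemma supp_mult_op: "supp (mult_op f) \<subseteq> {\<one>\<^bsub>V\<^esub>}"
  by (auto simp: skew_support_def mult_op_def)

lemma mult_op_closed: "f \<in> carrier Mer \<Longrightarrow> mult_op f \<in> carrier Skew"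
  by (rule SkewI[OF _ _ supp_mult_op]) (auto simp: mult_op_def)

lemma act_mult_op:
  assumes f: "f \<in> carrier Mer" and u: "u \<in> germ_families"
  shows "act (mult_op f) u = (\<lambda>y. f y \<otimes>\<^bsub>stalk y\<^esub> u y)"
proof
  fix y
  have "skew_term (mult_op f) u y \<one>\<^bsub>V\<^esub> = f y \<otimes>\<^bsub>stalk y\<^esub> u y"
    by (simp add: skew_term_def mult_op_def)
  then show "act (mult_op f) u y = f y \<otimes>\<^bsub>stalk y\<^esub> u y"
    using act_eq[OF mult_op_closed[OF f] u _ supp_mult_op] Mer_in_stalk[OF f] familyD[OF u]
    by (simp add: stalk.finsum_insert)
qed

lemma Skew_one_eq: "\<one>\<^bsub>Skew\<^esub> = mult_op \<one>\<^bsub>Mer\<^esub>"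
  by (simp add: skew_ring_def mult_op_def)

lemma act_one: "u \<in> germ_families \<Longrightarrow> act \<one>\<^bsub>Skew\<^esub> u = u"
  by (simp add: Skew_one_eq act_mult_op Mer_one familyD)

text \<open>
  Every identity about products is checked on the action, where products become compositions;
  the additive structure is that of functions into a group.
\<close>

lemma ring_Skew: "ring Skew"
proof (rule ringI)
  have zero: "\<zero>\<^bsub>Skew\<^esub> = (\<lambda>\<xi>. \<zero>\<^bsub>Mer\<^esub>)" by (simp add: skew_ring_def)
  have zero_closed: "\<zero>\<^bsub>Skew\<^esub> \<in> carrier Skew"
    by (rule SkewI[of _ "{}"]) (auto simp: zero skew_support_def)
  have one_closed: "\<one>\<^bsub>Skew\<^esub> \<in> carrier Skew" by (simp add: Skew_one_eq mult_op_closed Mer_one)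
  note closed = Skew_add_closed Skew_mult_closed act_closed zero_closed one_closed
  show "abelian_group Skew"
  proof (rule abelian_groupI)
    fix A assume A: "A \<in> carrier Skew"
    let ?B = "\<lambda>\<xi>. \<ominus>\<^bsub>Mer\<^esub> A \<xi>"
    have "supp ?B \<subseteq> supp A" by (auto simp: skew_support_def)
    then have "?B \<in> carrier Skew" using SkewD[OF A] by (intro SkewI[of _ "supp A"]) auto
    moreover have "?B \<oplus>\<^bsub>Skew\<^esub> A = \<zero>\<^bsub>Skew\<^esub>"
      using SkewD(1)[OF A] by (simp add: fun_eq_iff Skew_add_apply zero Mer.l_neg del: Mer_simps)
    ultimately show "\<exists>B\<in>carrier Skew. B \<oplus>\<^bsub>Skew\<^esub> A = \<zero>\<^bsub>Skew\<^esub>" by blast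
  qed (use zero_closed in \<open>auto intro!: Skew_add_closed intro: Mer.a_comm simp del: Mer_simps
      simp: fun_eq_iff[of "_ :: 'a \<Rightarrow> 'a \<Rightarrow> 'a mgerm"] Skew_add_apply zero SkewD Mer.a_assoc\<close>)
  show "monoid Skew"
  proof (rule monoidI)
    fix A B C assume *: "A \<in> carrier Skew" "B \<in> carrier Skew" "C \<in> carrier Skew"
    then show "A \<otimes>\<^bsub>Skew\<^esub> B \<otimes>\<^bsub>Skew\<^esub> C = A \<otimes>\<^bsub>Skew\<^esub> (B \<otimes>\<^bsub>Skew\<^esub> C)"
      by (intro act_faithful) (simp_all add: closed act_mult)
  next
    fix A assume A: "A \<in> carrier Skew"
    then show "\<one>\<^bsub>Skew\<^esub> \<otimes>\<^bsub>Skew\<^esub> A = A" "A \<otimes>\<^bsub>Skew\<^esub> \<one>\<^bsub>Skew\<^esub> = A"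
      by (intro act_faithful; simp add: closed act_mult act_one)+
  qed (auto intro: closed)
  fix A B C assume *: "A \<in> carrier Skew" "B \<in> carrier Skew" "C \<in> carrier Skew"
  then show "(A \<oplus>\<^bsub>Skew\<^esub> B) \<otimes>\<^bsub>Skew\<^esub> C = A \<otimes>\<^bsub>Skew\<^esub> C \<oplus>\<^bsub>Skew\<^esub> B \<otimes>\<^bsub>Skew\<^esub> C"
    by (intro act_faithful) (simp_all add: closed act_mult act_add)
  from * show "C \<otimes>\<^bsub>Skew\<^esub> (A \<oplus>\<^bsub>Skew\<^esub> B) = C \<otimes>\<^bsub>Skew\<^esub> A \<oplus>\<^bsub>Skew\<^esub> C \<otimes>\<^bsub>Skew\<^esub> B"
    by (intro act_faithful) (simp_all add: closed act_mult act_add act_add_family)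
qed

end

section \<open>The residue module\<close>

locale preserved_orbit = complex_lie V E \<Phi>
  for V :: "'a::t2_space monoid" and E :: "(complex ^ 'n::finite) set"
    and \<Phi> :: "('a, complex ^ 'n) atlas" +
  fixes Y :: "'a set" and \<A> :: "('a \<Rightarrow> 'a \<Rightarrow> 'a mgerm) set"
  assumes subring_A: "subring \<A> (skew_ring V \<Phi>)"
    and preserves: "preserves_holo_germs V \<Phi> \<A> Y"
begin

abbreviation H :: "('a \<Rightarrow> 'a mgerm) set"
where
  "H \<equiv> holo_germs_on \<Phi> Y"

abbreviation M :: "('a \<Rightarrow> 'a \<Rightarrow> 'a mgerm, 'a \<Rightarrow> 'a mgerm set) module"
where
  "M \<equiv> residue_module V \<Phi> Y"

text \<open>
  The projection to the residue module from the families of holomorphic germs on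
  \<open>Y\<close>.
\<close>

definition reduce :: "('a \<Rightarrow> 'a mgerm) \<Rightarrow> 'a \<Rightarrow> 'a mgerm set"
where
  "reduce u = (\<lambda>x\<in>Y. residue x (u x))"

lemma A_Skew: "A \<in> \<A> \<Longrightarrow> A \<in> carrier Skew"
  using subringE(1)[OF subring_A] by blast

lemma HD:
  assumes "u \<in> H"
  shows "x \<in> Y \<Longrightarrow> u x \<in> holo_carrier x" "x \<notin> Y \<Longrightarrow> u x = \<zero>\<^bsub>stalk x\<^esub>"
    "finite {x. u x \<noteq> \<zero>\<^bsub>stalk x\<^esub>}" "u x \<in> holo_carrier x"
proof -
  show in_Y: "u x \<in> holo_carrier x" if "x \<in> Y" using assms that unfolding holo_germs_on_def by simp
  show off_Y: "u x = \<zero>\<^bsub>stalk x\<^esub>" if "x \<notin> Y" using assms that unfolding holo_germs_on_def by simp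
  show "finite {x. u x \<noteq> \<zero>\<^bsub>stalk x\<^esub>}" using assms unfolding holo_germs_on_def by simp
  show "u x \<in> holo_carrier x" by (cases "x \<in> Y") (simp_all add: in_Y off_Y)
qed

lemma HI:
  assumes "\<And>x. x \<in> Y \<Longrightarrow> u x \<in> holo_carrier x" "finite T" "\<And>x. x \<notin> T \<Longrightarrow> u x = \<zero>\<^bsub>stalk x\<^esub>"
    "\<And>x. x \<notin> Y \<Longrightarrow> u x = \<zero>\<^bsub>stalk x\<^esub>"
  shows "u \<in> H"
proof -
  have "{x. u x \<noteq> \<zero>\<^bsub>stalk x\<^esub>} \<subseteq> T" using assms(3) by blast
  then show ?thesis using assms finite_subset unfolding holo_germs_on_def by blast
qed

lemma H_family: "u \<in> H \<Longrightarrow> u \<in> germ_families"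
  unfolding germ_families_def using HD(4) holo_in_stalk by blast

lemma H_zero: "zero_family \<in> H"
  by (rule HI[of _ "{}"]) auto

lemma holo_carrier_add: "F \<in> holo_carrier x \<Longrightarrow> G \<in> holo_carrier x \<Longrightarrow> F \<oplus>\<^bsub>stalk x\<^esub> G \<in> holo_carrier x"
  using subringE(7)[OF subcring.axioms(1)[OF subcring_holo]] .

lemma holo_carrier_mult: "F \<in> holo_carrier x \<Longrightarrow> G \<in> holo_carrier x \<Longrightarrow> F \<otimes>\<^bsub>stalk x\<^esub> G \<in> holo_carrier x"
  using subringE(6)[OF subcring.axioms(1)[OF subcring_holo]] .

lemma H_add:
  assumes "u \<in> H" "w \<in> H"
  shows "add_family u w \<in> H"
  by (rule HI[of _ "{x. u x \<noteq> \<zero>\<^bsub>stalk x\<^esub>} \<union> {x. w x \<noteq> \<zero>\<^bsub>stalk x\<^esub>}"])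
    (use HD[OF assms(1)] HD[OF assms(2)] in \<open>auto intro: holo_carrier_add\<close>)

lemma H_point: "x \<in> Y \<Longrightarrow> F \<in> holo_carrier x \<Longrightarrow> point_family x F \<in> H"
  by (rule HI[of _ "{x}"]) (auto simp: point_family_def)

lemma H_act: "A \<in> \<A> \<Longrightarrow> u \<in> H \<Longrightarrow> act A u \<in> H"
  using preserves unfolding preserves_holo_germs_def by blast

text \<open>
  The coefficient is the image of the unit germ at \<open>\<xi>\<^sup>-\<^sup>1 y\<close>, a
  point of \<open>Y\<close>, so preservation of holomorphic germs makes it holomorphic. For
  \<open>\<xi>\<^sup>-\<^sup>1 y\<close> outside \<open>Y\<close> nothing of the sort can be
  said, and such terms act on families on \<open>Y\<close> by zero.
\<close>

lemma coefficient_holo: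
  assumes A: "A \<in> \<A>" and y: "y \<in> Y" "inv\<^bsub>V\<^esub> \<xi> \<otimes>\<^bsub>V\<^esub> y \<in> Y"
  shows "A \<xi> y \<in> holo_carrier y"
proof -
  let ?x = "inv\<^bsub>V\<^esub> \<xi> \<otimes>\<^bsub>V\<^esub> y"
  have "act A (point_family ?x \<one>\<^bsub>stalk ?x\<^esub>) \<in> H"
    using A y by (intro H_act H_point) auto
  then have "act A (point_family ?x \<one>\<^bsub>stalk ?x\<^esub>) y \<in> holo_carrier y" by (rule HD)
  then show ?thesis
    using A_Skew[OF A] by (simp add: act_point_family SkewD)
qed

text \<open>
  The two parts support each other: additivity of the value requires the partial sums to be
  holomorphic.
\<close>

lemma germ_value_finsum:
  assumes "finite I" "\<And>i. i \<in> I \<Longrightarrow> f i \<in> holo_carrier y"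
  shows "finsum (stalk y) f I \<in> holo_carrier y"
    and "germ_value y (finsum (stalk y) f I) = (\<Sum>i\<in>I. germ_value y (f i))"
proof -
  have "finsum (stalk y) f I \<in> holo_carrier y \<and>
      germ_value y (finsum (stalk y) f I) = (\<Sum>i\<in>I. germ_value y (f i))"
    using assms
  proof (induction I rule: finite_induct)
    case (insert i I)
    then show ?case
      by (simp add: stalk.finsum_insert Pi_def holo_in_stalk holo_carrier_add germ_value_add)
  qed simp
  then show "finsum (stalk y) f I \<in> holo_carrier y"
    "germ_value y (finsum (stalk y) f I) = (\<Sum>i\<in>I. germ_value y (f i))" by auto
qed

lemma germ_value_act:
  assumes A: "A \<in> \<A>" and u: "u \<in> H" and y: "y \<in> Y"
  shows "germ_value y (act A u y) = (\<Sum>\<xi>\<in>supp A. if inv\<^bsub>V\<^esub> \<xi> \<otimes>\<^bsub>V\<^esub> y \<in> Y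
    then germ_value y (A \<xi> y) * germ_value (inv\<^bsub>V\<^esub> \<xi> \<otimes>\<^bsub>V\<^esub> y) (u (inv\<^bsub>V\<^esub> \<xi> \<otimes>\<^bsub>V\<^esub> y)) else 0)"
proof -
  note A' = A_Skew[OF A]
  have "skew_term A u y \<xi> \<in> holo_carrier y \<and> germ_value y (skew_term A u y \<xi>) =
      (if inv\<^bsub>V\<^esub> \<xi> \<otimes>\<^bsub>V\<^esub> y \<in> Y
        then germ_value y (A \<xi> y) * germ_value (inv\<^bsub>V\<^esub> \<xi> \<otimes>\<^bsub>V\<^esub> y) (u (inv\<^bsub>V\<^esub> \<xi> \<otimes>\<^bsub>V\<^esub> y)) else 0)" for \<xi>
  proof (cases "inv\<^bsub>V\<^esub> \<xi> \<otimes>\<^bsub>V\<^esub> y \<in> Y")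
    case True
    have "translate_germ V \<xi> (u (inv\<^bsub>V\<^esub> \<xi> \<otimes>\<^bsub>V\<^esub> y)) \<in> holo_carrier y"
      using HD(1)[OF u True] by (rule translate_germ_holo)
    then show ?thesis
      using True coefficient_holo[OF A y True] HD(1)[OF u True]
      by (simp add: skew_term_def holo_carrier_mult germ_value_mult germ_value_translate)
  next
    case False
    then show ?thesis using HD(2)[OF u False] SkewD(3)[OF A'] by (simp add: skew_term_def)
  qed
  then show ?thesis
    using germ_value_finsum(2)[OF SkewD(2)[OF A'], of "skew_term A u y" y]
    by (simp add: act_eq[OF A' H_family[OF u] SkewD(2)[OF A'] order_refl])
qed

lemma reduce_eq_iff:
  assumes "u \<in> H" "w \<in> H"
  shows "reduce u = reduce w \<longleftrightarrow> (\<forall>x\<in>Y. germ_value x (u x) = germ_value x (w x))"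
proof -
  have "reduce u = reduce w \<longleftrightarrow> (\<forall>x\<in>Y. residue x (u x) = residue x (w x))"
    by (auto simp: reduce_def fun_eq_iff restrict_def)
  then show ?thesis by (simp add: HD(4)[OF assms(1)] HD(4)[OF assms(2)] residue_eq_iff)
qed

text \<open>
  This is what makes the action on cosets well defined.
\<close>

lemma reduce_act_cong:
  assumes A: "A \<in> \<A>" and u: "u \<in> H" and w: "w \<in> H" and eq: "reduce u = reduce w"
  shows "reduce (act A u) = reduce (act A w)"
proof -
  have "germ_value y (act A u y) = germ_value y (act A w y)" if y: "y \<in> Y" for y
    unfolding germ_value_act[OF A u y] germ_value_act[OF A w y]
    using eq[unfolded reduce_eq_iff[OF u w]] by (intro sum.cong) auto
  then show ?thesis by (simp add: reduce_eq_iff H_act A u w)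
qed

lemma carrier_Quot: "carrier (holo_stalk \<Phi> x Quot vanishing_germs \<Phi> x) = residue x ` holo_carrier x"
  by (auto simp: FactRing_def A_RCOSETS_def')

lemma zero_Quot: "\<zero>\<^bsub>holo_stalk \<Phi> x Quot vanishing_germs \<Phi> x\<^esub> = residue x \<zero>\<^bsub>stalk x\<^esub>"
proof -
  interpret I: ideal "vanishing_germs \<Phi> x" "holo_stalk \<Phi> x" by (rule ideal_vanishing)
  show ?thesis
    unfolding FactRing_def ring.simps holo_stalk_simps(4)[symmetric]
    by (rule I.a_coset_add_zero[OF I.a_subset, symmetric])
qed

lemma add_Quot:
  assumes "F \<in> holo_carrier x" "G \<in> holo_carrier x"
  shows "residue x F \<oplus>\<^bsub>holo_stalk \<Phi> x Quot vanishing_germs \<Phi> x\<^esub> residue x G = residue x (F \<oplus>\<^bsub>stalk x\<^esub> G)"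
proof -
  interpret I: ideal "vanishing_germs \<Phi> x" "holo_stalk \<Phi> x" by (rule ideal_vanishing)
  show ?thesis
    unfolding FactRing_def ring.simps holo_stalk_simps(3)[symmetric]
    by (rule I.a_rcos_sum[OF assms])
qed

text \<open>
  A family of cosets with finite support lifts to a family of germs with finite support once the
  zero coset is lifted to the zero germ.
\<close>

lemma carrier_M: "carrier M = reduce ` H"
proof
  show "reduce ` H \<subseteq> carrier M"
  proof clarify
    fix u assume u: "u \<in> H"
    have "{x \<in> Y. reduce u x \<noteq> residue x \<zero>\<^bsub>stalk x\<^esub>} \<subseteq> {x. u x \<noteq> \<zero>\<^bsub>stalk x\<^esub>}"
      by (auto simp: reduce_def)
    then have "finite {x \<in> Y. reduce u x \<noteq> residue x \<zero>\<^bsub>stalk x\<^esub>}"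
      using HD(3)[OF u] finite_subset by blast
    then show "reduce u \<in> carrier M"
      using HD(4)[OF u] by (simp add: residue_module_def Let_def zero_Quot carrier_Quot reduce_def)
  qed
  show "carrier M \<subseteq> reduce ` H"
  proof
    fix c assume "c \<in> carrier M"
    then have c: "c \<in> (\<Pi>\<^sub>E x\<in>Y. residue x ` holo_carrier x)"
      and fin: "finite {x \<in> Y. c x \<noteq> residue x \<zero>\<^bsub>stalk x\<^esub>}"
      by (simp_all add: residue_module_def Let_def zero_Quot carrier_Quot)
    from c have "\<forall>x\<in>Y. \<exists>F\<in>holo_carrier x. c x = residue x F" by (fastforce simp: PiE_iff)
    then have "\<exists>F. \<forall>x\<in>Y. F x \<in> holo_carrier x \<and> c x = residue x (F x)"
      by (intro bchoice) blast
    then obtain F where F: "\<And>x. x \<in> Y \<Longrightarrow> F x \<in> holo_carrier x" "\<And>x. x \<in> Y \<Longrightarrow> c x = residue x (F x)"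
      by blast
    \<comment> \<open>Choosing the zero germ for zero cosets keeps the support finite.\<close>
    define u where "u x = (if x \<in> {x \<in> Y. c x \<noteq> residue x \<zero>\<^bsub>stalk x\<^esub>} then F x else \<zero>\<^bsub>stalk x\<^esub>)" for x
    have "u \<in> H" by (rule HI[OF _ fin]) (auto simp: u_def F(1))
    moreover have "c = reduce u"
    proof
      fix x show "c x = reduce u x"
        using c F(2)[of x] by (cases "x \<in> Y") (auto simp: reduce_def u_def PiE_iff extensional_def)
    qed
    ultimately show "c \<in> reduce ` H" by blast
  qed
qed

lemma M_zero: "\<zero>\<^bsub>M\<^esub> = reduce zero_family"
  by (simp add: residue_module_def Let_def zero_Quot reduce_def)

lemma M_add:
  assumes "u \<in> H" "w \<in> H"
  shows "reduce u \<oplus>\<^bsub>M\<^esub> reduce w = reduce (add_family u w)"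
  using HD(4)[OF assms(1)] HD(4)[OF assms(2)]
  by (simp add: residue_module_def Let_def reduce_def add_Quot cong: restrict_cong)

text \<open>
  The union in the definition of the action runs over all lifts of the family of cosets, and all
  lifts give the same coset.
\<close>

lemma M_smult:
  assumes A: "A \<in> \<A>" and u: "u \<in> H"
  shows "A \<odot>\<^bsub>M\<^esub> reduce u = reduce (act A u)"
proof
  fix y
  let ?L = "{w \<in> H. \<forall>x\<in>Y. w x \<in> reduce u x}"
  have L: "?L = {w \<in> H. reduce w = reduce u}"
    by (auto simp: reduce_eq_iff u HD(4)) (auto simp: reduce_def mem_residue_iff HD(4)[OF u] HD(4))
  have "(\<Union>w\<in>?L. residue y (act A w y)) = residue y (act A u y)" if y: "y \<in> Y"
  proof -
    have const: "residue y (act A w y) = residue y (act A u y)" if "w \<in> ?L" for w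
    proof -
      have "reduce (act A w) y = reduce (act A u) y"
        using reduce_act_cong[OF A _ u] that by (simp add: L)
      then show ?thesis using y by (simp add: reduce_def)
    qed
    have "u \<in> ?L" using u by (simp add: L)
    then have ne: "?L \<noteq> {}" by blast
    have "(\<Union>w\<in>?L. residue y (act A w y)) = (\<Union>w\<in>?L. residue y (act A u y))"
      by (rule SUP_cong[OF refl const])
    also have "\<dots> = residue y (act A u y)" by (rule cSUP_const[OF ne])
    finally show ?thesis .
  qed
  then show "(A \<odot>\<^bsub>M\<^esub> reduce u) y = reduce (act A u) y"
    by (cases "y \<in> Y") (simp_all add: residue_module_def Let_def, simp_all add: reduce_def)
qed

lemma act_zero: "u \<in> germ_families \<Longrightarrow> act \<zero>\<^bsub>Skew\<^esub> u = zero_family"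
  by (simp add: skew_act_def skew_support_def skew_ring_def)

text \<open>
  The module axioms are inherited along \<open>reduce\<close> from the action on families of
  germs; the additive inverse is the action of \<open>-1\<close>.
\<close>

lemma left_module_M: "left_module (Skew\<lparr>carrier := \<A>\<rparr>) M"
proof (intro left_module.intro left_module_axioms.intro)
  interpret S: ring Skew by (rule ring_Skew)
  show "ring (Skew\<lparr>carrier := \<A>\<rparr>)" by (rule S.subring_is_ring[OF subring_A])
  let ?m = "\<ominus>\<^bsub>Skew\<^esub> \<one>\<^bsub>Skew\<^esub>"
  have m: "?m \<in> \<A>" using subringE(3,5)[OF subring_A] by blast
  have neg: "add_family (act ?m u) u = zero_family" if u: "u \<in> H" for u
  proof -
    have "add_family (act ?m u) (act \<one>\<^bsub>Skew\<^esub> u) = act (?m \<oplus>\<^bsub>Skew\<^esub> \<one>\<^bsub>Skew\<^esub>) u"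
      by (rule act_add[symmetric]) (use H_family[OF u] in auto)
    then show ?thesis
      using H_family[OF u] by (simp add: act_one S.l_neg act_zero)
  qed
  show "abelian_group M"
  proof (rule abelian_groupI)
    fix c assume "c \<in> carrier M"
    then obtain u where u: "u \<in> H" "c = reduce u" unfolding carrier_M by blast
    then have "reduce (act ?m u) \<oplus>\<^bsub>M\<^esub> c = \<zero>\<^bsub>M\<^esub>"
      using neg by (simp add: M_add H_act m M_zero)
    then show "\<exists>d\<in>carrier M. d \<oplus>\<^bsub>M\<^esub> c = \<zero>\<^bsub>M\<^esub>"
      using H_act[OF m u(1)] unfolding carrier_M by blast
  qed (auto simp: carrier_M M_add M_zero H_add H_zero stalk.a_ac familyD H_family)
qed (auto simp: carrier_M M_smult M_add H_add H_act A_Skew act_add act_add_family act_mult act_one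
    H_family subringE(3,6,7)[OF subring_A])

end

section \<open>Irreducibility\<close>

context complex_manifold
begin

text \<open>
  A product over \<open>y \<in> T\<close> of the functions \<open>(g - g y) / (g x - g
  y)\<close>, where \<open>g\<close> separates \<open>x\<close> from \<open>y\<close>.
\<close>

lemma isolating_function:
  assumes sep: "holo_separates_points \<Phi> Y" and T: "finite T" "T \<subseteq> Y" and x: "x \<in> Y" "x \<notin> T"
  obtains f where "holo_on \<Phi> UNIV f" "f x = 1" "\<And>y. y \<in> T \<Longrightarrow> f y = 0"
proof -
  have "\<exists>f. holo_on \<Phi> UNIV f \<and> f x = 1 \<and> (\<forall>y\<in>T. f y = 0)"
    using T x(2)
  proof (induction T rule: finite_induct)
    case empty
    show ?case by (rule exI[of _ "\<lambda>y. 1"]) (simp add: holo_on_const)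
  next
    case (insert y T)
    then obtain f where f: "holo_on \<Phi> UNIV f" "f x = 1" "\<forall>z\<in>T. f z = 0" by auto
    obtain g where g: "holo_on \<Phi> UNIV g" "g x \<noteq> g y"
      using sep x(1) insert.prems unfolding holo_separates_points_def by (metis insert_iff insert_subset)
    let ?h = "\<lambda>z. f z * ((g z - g y) * inverse (g x - g y))"
    have "holo_on \<Phi> UNIV ?h"
      by (intro holo_on_mult holo_on_diff f(1) g(1) holo_on_const)
    then show ?case using f g by (intro exI[of _ ?h]) auto
  qed
  then show ?thesis using that by blast
qed

end

context preserved_orbit
begin

text \<open>
  Multiply \<open>u\<close> by a global function that vanishes at the other points of its
  support and has the right value at \<open>x\<close>.
\<close>

lemma submodule_localize:
  assumes holo: "global_holo V \<Phi> \<subseteq> \<A>" and sep: "holo_separates_points \<Phi> Y"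
    and N: "submodule N (Skew\<lparr>carrier := \<A>\<rparr>) M"
    and u: "u \<in> H" "reduce u \<in> N" and x: "x \<in> Y" "germ_value x (u x) \<noteq> 0"
    and F: "F \<in> holo_carrier x"
  shows "reduce (point_family x F) \<in> N"
proof -
  define T where "T = {y. u y \<noteq> \<zero>\<^bsub>stalk y\<^esub>} - {x}"
  have "finite T" "T \<subseteq> Y" "x \<notin> T" using HD(2,3)[OF u(1)] by (auto simp: T_def)
  then obtain f where f: "holo_on \<Phi> UNIV f" "f x = 1" "\<And>y. y \<in> T \<Longrightarrow> f y = 0"
    using isolating_function[OF sep _ _ x(1)] by metis
  \<comment> \<open>The factor \<open>k\<close> corrects the value at \<open>x\<close>, since the function \<open>f\<close> is normalised to \<open>1\<close> there.\<close>
  define k where "k = germ_value x F / germ_value x (u x)"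
  define g where "g = (\<lambda>y. k * f y)"
  have g: "holo_on \<Phi> UNIV g" unfolding g_def by (intro holo_on_mult holo_on_const f(1))
  let ?A = "mult_op (\<lambda>y. holo_germ y g)"
  have A: "?A \<in> \<A>"
    using holo g unfolding global_holo_def mult_op_def by blast
  have val: "germ_value y (act ?A u y) = g y * germ_value y (u y)" for y
    using HD(4)[OF u(1)] g
    by (simp add: act_mult_op[OF Mer_holo[OF g] H_family[OF u(1)]] germ_value_mult holo_germ_closed holo_near_global)
  have "reduce (act ?A u) = reduce (point_family x F)"
  proof (subst reduce_eq_iff[OF H_act[OF A u(1)] H_point[OF x(1) F]], intro ballI)
    fix y
    show "germ_value y (act ?A u y) = germ_value y (point_family x F y)"
    proof (cases "y = x")
      case True
      then show ?thesis
        using x(2) f(2) by (simp only: val) (simp add: point_family_def g_def k_def)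
    next
      case False
      have "g y * germ_value y (u y) = 0"
      proof (cases "u y = \<zero>\<^bsub>stalk y\<^esub>")
        case False
        with \<open>y \<noteq> x\<close> have "f y = 0" by (intro f(3)) (simp add: T_def)
        then show ?thesis by (simp add: g_def)
      qed simp
      with False show ?thesis by (simp only: val) (simp add: point_family_def)
    qed
  qed
  moreover have "?A \<odot>\<^bsub>M\<^esub> reduce u \<in> N"
    using submodule.smult_closed[OF N _ u(2)] A by simp
  ultimately show ?thesis by (simp add: M_smult[OF A u(1)])
qed

text \<open>
  Starting from one nonzero element, \<open>submodule_localize\<close> gives the line of one
  point of \<open>Y\<close>, arrows carry it to every other point, and finite sums give the
  whole module.
\<close>

theorem irreducible_M:
  assumes holo: "global_holo V \<Phi> \<subseteq> \<A>" and sep: "holo_separates_points \<Phi> Y"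
    and conn: "oriented_connected Y (graph_arrows V \<Phi> \<A> Y)" and ne: "Y \<noteq> {}"
  shows "irreducible_module (Skew\<lparr>carrier := \<A>\<rparr>) M"
  unfolding irreducible_module_def
proof (intro conjI allI impI)
  show "left_module (Skew\<lparr>carrier := \<A>\<rparr>) M" by (rule left_module_M)
  obtain x where x: "x \<in> Y" using ne by blast
  have "reduce (point_family x \<one>\<^bsub>stalk x\<^esub>) \<noteq> \<zero>\<^bsub>M\<^esub>"
    unfolding M_zero reduce_eq_iff[OF H_point[OF x one_in_holo] H_zero]
    using x by (auto simp: point_family_def intro!: bexI[of _ x])
  then show "carrier M \<noteq> {\<zero>\<^bsub>M\<^esub>}"
    using H_point[OF x one_in_holo] unfolding carrier_M by blast
  fix N assume N: "submodule N (Skew\<lparr>carrier := \<A>\<rparr>) M"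
  interpret N: submodule N "Skew\<lparr>carrier := \<A>\<rparr>" M by (rule N)
  have sub: "N \<subseteq> reduce ` H" using N.subset by (simp add: carrier_M)
  have N_add: "c \<oplus>\<^bsub>M\<^esub> d \<in> N" if "c \<in> N" "d \<in> N" for c d
    using N.m_closed[OF that] by simp
  have N_zero: "\<zero>\<^bsub>M\<^esub> \<in> N" using N.one_closed by simp
  note localize = submodule_localize[OF holo sep N]
  show "N = {\<zero>\<^bsub>M\<^esub>} \<or> N = carrier M"
  proof (rule disjCI)
    assume "N \<noteq> carrier M"
    show "N = {\<zero>\<^bsub>M\<^esub>}"
    proof (rule ccontr)
      assume "N \<noteq> {\<zero>\<^bsub>M\<^esub>}"
      then obtain c where c: "c \<in> N" "c \<noteq> \<zero>\<^bsub>M\<^esub>" using N_zero by blast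
      then obtain u where u: "u \<in> H" "c = reduce u" using sub by blast
      then obtain x where x: "x \<in> Y" "germ_value x (u x) \<noteq> 0"
        using c(2) by (auto simp: M_zero reduce_eq_iff H_zero)
      have arrow_step: "\<forall>G\<in>holo_carrier z. reduce (point_family z G) \<in> N"
        if arrow: "(y, z) \<in> graph_arrows V \<Phi> \<A> Y"
          and y: "\<forall>G\<in>holo_carrier y. reduce (point_family y G) \<in> N" for y z
      proof
        fix G assume G: "G \<in> holo_carrier z"
        from arrow obtain A \<xi> g where yz: "y \<in> Y" "z \<in> Y" "A \<in> \<A>" "\<xi> \<otimes>\<^bsub>V\<^esub> y = z"
          and g: "holo_near \<Phi> z g" "A \<xi> z = holo_germ z g" "g z \<noteq> 0"
          unfolding graph_arrows_def by blast
        have y_eq: "y = inv\<^bsub>V\<^esub> \<xi> \<otimes>\<^bsub>V\<^esub> z" using yz(4) by auto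
        let ?w = "point_family y \<one>\<^bsub>stalk y\<^esub>"
        have w: "?w \<in> H" using yz(1) by (rule H_point) simp
        have "A \<odot>\<^bsub>M\<^esub> reduce ?w \<in> N" using y yz(3) by simp
        then have "reduce (act A ?w) \<in> N" by (simp add: M_smult[OF yz(3) w])
        moreover have "act A ?w z = holo_germ z g"
          using A_Skew[OF yz(3)] g SkewD(3)[OF A_Skew[OF yz(3)], of \<xi> z] unfolding y_eq
          by (simp add: act_point_family)
        then have "germ_value z (act A ?w z) \<noteq> 0" using g by simp
        ultimately show "reduce (point_family z G) \<in> N"
          using localize[OF H_act[OF yz(3) w] _ yz(2) _ G] by blast
      qed
      have points: "reduce (point_family y G) \<in> N" if y: "y \<in> Y" and G: "G \<in> holo_carrier y" for y G
      proof -
        have "(x, y) \<in> (graph_arrows V \<Phi> \<A> Y)\<^sup>*"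
          using conn x(1) y unfolding oriented_connected_def by blast
        then have "\<forall>G\<in>holo_carrier y. reduce (point_family y G) \<in> N"
        proof (induction rule: rtrancl_induct)
          case base
          show ?case using localize[OF u(1) _ x] c(1) u(2) by simp
        next
          case (step y z)
          then show ?case using arrow_step by blast
        qed
        then show ?thesis using G by blast
      qed
      have all: "reduce w \<in> N" if "finite T" "w \<in> H" "{y. w y \<noteq> \<zero>\<^bsub>stalk y\<^esub>} \<subseteq> T" for w T
        using that
      proof (induction T arbitrary: w rule: finite_induct)
        case empty
        then have "w = zero_family" by (simp add: fun_eq_iff)
        then show ?case using N_zero by (simp add: M_zero)
      next
        case (insert y T)
        show ?case
        proof (cases "y \<in> Y")
          case False
          then have "w y = \<zero>\<^bsub>stalk y\<^esub>" by (rule HD(2)[OF insert.prems(1)])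
          then have "{z. w z \<noteq> \<zero>\<^bsub>stalk z\<^esub>} \<subseteq> T" using insert.prems(2) by auto
          then show ?thesis using insert.IH insert.prems(1) by blast
        next
          case True
          let ?w = "w(y := \<zero>\<^bsub>stalk y\<^esub>)"
          have w: "?w \<in> H"
            by (rule HI[OF _ HD(3)[OF insert.prems(1)]]) (use HD[OF insert.prems(1)] in auto)
          have p: "point_family y (w y) \<in> H" using True HD(4)[OF insert.prems(1)] by (rule H_point)
          have "w = add_family (point_family y (w y)) ?w"
            using H_family[OF insert.prems(1)] by (auto simp: point_family_def fun_eq_iff familyD)
          then have "reduce w = reduce (point_family y (w y)) \<oplus>\<^bsub>M\<^esub> reduce ?w"
            using M_add[OF p w] by simp
          moreover have "{z. ?w z \<noteq> \<zero>\<^bsub>stalk z\<^esub>} \<subseteq> T" using insert.prems(2) by auto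
          then have "reduce ?w \<in> N" using insert.IH w by blast
          ultimately show ?thesis
            using N_add points[OF True HD(4)[OF insert.prems(1)]] by simp
        qed
      qed
      have "reduce ` H \<subseteq> N" by (intro image_subsetI) (rule all[OF HD(3) _ order_refl])
      then show False using \<open>N \<noteq> carrier M\<close> sub by (simp add: carrier_M)
    qed
  qed
qed

end

theorem proposition29:
  fixes V :: "'a::t2_space monoid"
    and E :: "(complex ^ 'n::finite) set"
    and \<Phi> :: "('a, complex ^ 'n) atlas"
    and gimel :: "'a set" and v :: 'a
    and \<A> :: "('a \<Rightarrow> 'a \<Rightarrow> 'a mgerm) set"
  assumes "complex_lie_group V E \<Phi>"
    and "subgroup gimel V"
    and "v \<in> carrier V"
    and "subring \<A> (skew_ring V \<Phi>)"
    and "finitely_generated_over_holo V \<Phi> \<A>"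
    and "preserves_holo_germs V \<Phi> \<A> (gimel #>\<^bsub>V\<^esub> v)"
    and "holo_separates_points \<Phi> (gimel #>\<^bsub>V\<^esub> v)"
    and "oriented_connected (gimel #>\<^bsub>V\<^esub> v) (graph_arrows V \<Phi> \<A> (gimel #>\<^bsub>V\<^esub> v))"
  shows "irreducible_module ((skew_ring V \<Phi>)\<lparr>carrier := \<A>\<rparr>)
    (residue_module V \<Phi> (gimel #>\<^bsub>V\<^esub> v))"
proof -
  interpret preserved_orbit V E \<Phi> "gimel #>\<^bsub>V\<^esub> v" \<A>
    using assms by (intro preserved_orbit.intro complex_lie.intro preserved_orbit_axioms.intro)
  have "global_holo V \<Phi> \<subseteq> \<A>"
    using assms(5) unfolding finitely_generated_over_holo_def by (auto intro: generate_ring.incl)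
  moreover have "gimel #>\<^bsub>V\<^esub> v \<noteq> {}"
    using subgroup.one_closed[OF assms(2)] by (auto simp: r_coset_def)
  ultimately show ?thesis
    by (intro irreducible_M assms(7,8))
qed

end
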